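(* Let $R$ be a standard graded polynomial ring over a field $k$ with graded maximal ideal $\mathfrak m$, and let $I\subseteq \mathfrak m^2$ be a homogeneous ideal. Let $s\ge 1$ be an integer. Assume that one of the following conditions holds: (i) $\operatorname{char} k=0$; (ii) $I$ is a monomial ideal; (iii) $I^t$ is a Koszul $R$-module for all $1\le t\le s$. Then for every $1\le t\le s$, the inclusion map $\mathfrak m^{s-t}I^t\to \mathfrak m^{s-t+1}I^{t-1}$ is Tor-vanishing.
   Context: A homomorphism $\phi:M\to N$ of finitely generated graded $R$-modules is called Tor-vanishing if $\operatorname{Tor}^R_i(k,\phi)=0$ for all $i\ge 0$, where $k=R/\mathfrak m$. By convention $\mathfrak m^0=I^0=R$. Koszul modules: let $M$ be a finitely generated graded $R$-module with minimal graded free resolution $X$. For $i\ge 0$ let $\mathcal F^iX$ be the subcomplex $\cdots\to X_{i+1}\to X_i\to \mathfrak m X_{i-1}\to\cdots\to \mathfrak m^{i-1}X_1\to \mathfrak m^iX_0\to 0$, and let $\operatorname{lin}^R X=\bigoplus_{i\ge 0}\mathcal F^iX/\mathcal F^{i+1}X$. The linearity defect is $\operatorname{ld}_R M=\sup\{i: H_i(\operatorname{lin}^R X)\ne 0\}$, with $\operatorname{ld}_R(0)=0$; $M$ is Koszul if $\operatorname{ld}_R M=0$. *)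

theory Defs
  imports
    "HOL-Library.Poly_Mapping"
    "HOL-Library.Function_Algebras"
    "HOL-Library.Extended_Nat"
    "HOL-Computational_Algebra.Computational_Algebra"
begin

section \<open>Standard graded polynomial rings and their ideals\<close>

type_synonym ('x, 'k) mpoly = "('x \<Rightarrow>\<^sub>0 nat) \<Rightarrow>\<^sub>0 'k"

definition mdeg :: "('x::finite \<Rightarrow>\<^sub>0 nat) \<Rightarrow> nat" where
  "mdeg a = (\<Sum>x\<in>UNIV. Poly_Mapping.lookup a x)"

text \<open>The graded piece \<open>R\<^sub>d\<close>; it is zero for \<open>d < 0\<close>.\<close>

definition hom_part :: "int \<Rightarrow> ('x::finite, 'k::field) mpoly set" where
  "hom_part d = {f. \<forall>a\<in>Poly_Mapping.keys f. int (mdeg a) = d}"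

definition ideal_span :: "'r::comm_ring_1 set \<Rightarrow> 'r set" where
  "ideal_span S = module.span (*) S"

definition ideal_prod :: "'r::comm_ring_1 set \<Rightarrow> 'r set \<Rightarrow> 'r set" where
  "ideal_prod I J = ideal_span {a * b |a b. a \<in> I \<and> b \<in> J}"

primrec ideal_pow :: "'r::comm_ring_1 set \<Rightarrow> nat \<Rightarrow> 'r set" where
  "ideal_pow I 0 = UNIV"
| "ideal_pow I (Suc n) = ideal_prod I (ideal_pow I n)"

definition homogeneous_ideal :: "('x::finite, 'k::field) mpoly set \<Rightarrow> bool" where
  "homogeneous_ideal I \<longleftrightarrow> (\<exists>S. S \<subseteq> (\<Union>d. hom_part d) \<and> I = ideal_span S)"

definition monomial_ideal :: "('x::finite, 'k::field) mpoly set \<Rightarrow> bool" where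
  "monomial_ideal I \<longleftrightarrow> (\<exists>A. I = ideal_span ((\<lambda>a. Poly_Mapping.single a 1) ` A))"

definition max_ideal :: "('x::finite, 'k::field) mpoly set" where
  "max_ideal = ideal_span (range (\<lambda>x. Poly_Mapping.single (Poly_Mapping.single x 1) 1))"


section \<open>Complexes of finite free modules\<close>

text \<open>
  A complex \<open>\<dots> \<rightarrow> C\<^sub>1 \<rightarrow> C\<^sub>0 \<rightarrow> 0\<close> of free modules with chosen finite bases: \<open>rk C i\<close> is the
  rank of \<open>C\<^sub>i\<close>, and for \<open>i \<ge> 1\<close> the differential \<open>C\<^sub>i \<rightarrow> C\<^sub>i\<^sub>-\<^sub>1\<close> has the matrix
  \<open>dmat C i\<close> (row index first). The entries \<open>dmat C i r c\<close> with \<open>i = 0\<close>, \<open>r \<ge> rk C (i - 1)\<close>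
  or \<open>c \<ge> rk C i\<close> are irrelevant.
\<close>

record 'r free_complex =
  rk :: "nat \<Rightarrow> nat"
  dmat :: "nat \<Rightarrow> nat \<Rightarrow> nat \<Rightarrow> 'r"

text \<open>
  Modules are given by a scalar multiplication \<open>sc\<close> and a carrier \<open>M\<close>, a submodule of the
  underlying type. As \<open>C\<^sub>i\<close> is free on \<open>rk C i\<close> elements, \<open>C\<^sub>i \<otimes> M\<close> is the module of
  \<open>rk C i\<close>-tuples over \<open>M\<close>, padded by zeros to functions on \<open>nat\<close>, and the differential of
  \<open>C \<otimes> M\<close> is given by the same matrices. With \<open>M = UNIV\<close> over the ring itself this is \<open>C\<^sub>i\<close>;
  for an ideal \<open>J\<close> of the ring it is the submodule \<open>J C\<^sub>i\<close> of \<open>C\<^sub>i\<close>.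
\<close>

definition tensor_part :: "'r free_complex \<Rightarrow> 'm::ab_group_add set \<Rightarrow> nat \<Rightarrow> (nat \<Rightarrow> 'm) set" where
  "tensor_part C M i = {z. (\<forall>j<rk C i. z j \<in> M) \<and> (\<forall>j\<ge>rk C i. z j = 0)}"

definition tensor_diff ::
    "'r free_complex \<Rightarrow> ('r \<Rightarrow> 'm \<Rightarrow> 'm::ab_group_add) \<Rightarrow> nat \<Rightarrow> (nat \<Rightarrow> 'm) \<Rightarrow> nat \<Rightarrow> 'm" where
  "tensor_diff C sc i z =
     (\<lambda>r. if r < rk C (i - 1) then \<Sum>c<rk C i. sc (dmat C i r c) (z c) else 0)"

text \<open>
  The homology of the quotient complex with components \<open>Z\<^sub>i / N\<^sub>i\<close> and differentials induced
  by \<open>d\<^sub>i : Z\<^sub>i \<rightarrow> Z\<^sub>i\<^sub>-\<^sub>1\<close> (\<open>i \<ge> 1\<close>). Cycles and boundaries are represented by their preimages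
  in \<open>Z\<^sub>i\<close>; a homology class is a coset of the group of boundaries, which itself is the zero
  class.
\<close>

definition cycles :: "(nat \<Rightarrow> 'c set) \<Rightarrow> (nat \<Rightarrow> 'c set) \<Rightarrow> (nat \<Rightarrow> 'c \<Rightarrow> 'c::ab_group_add)
    \<Rightarrow> nat \<Rightarrow> 'c set" where
  "cycles Z N d i = {z \<in> Z i. i \<noteq> 0 \<longrightarrow> d i z \<in> N (i - 1)}"

definition boundaries :: "(nat \<Rightarrow> 'c set) \<Rightarrow> (nat \<Rightarrow> 'c set) \<Rightarrow> (nat \<Rightarrow> 'c \<Rightarrow> 'c::ab_group_add)
    \<Rightarrow> nat \<Rightarrow> 'c set" where
  "boundaries Z N d i = {d (Suc i) y + n |y n. y \<in> Z (Suc i) \<and> n \<in> N i}"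

definition homology :: "(nat \<Rightarrow> 'c set) \<Rightarrow> (nat \<Rightarrow> 'c set) \<Rightarrow> (nat \<Rightarrow> 'c \<Rightarrow> 'c::ab_group_add)
    \<Rightarrow> nat \<Rightarrow> 'c set set" where
  "homology Z N d i = (\<lambda>z. (\<lambda>b. z + b) ` boundaries Z N d i) ` cycles Z N d i"

definition homology_zero :: "(nat \<Rightarrow> 'c set) \<Rightarrow> (nat \<Rightarrow> 'c set) \<Rightarrow> (nat \<Rightarrow> 'c \<Rightarrow> 'c::ab_group_add)
    \<Rightarrow> nat \<Rightarrow> bool" where
  "homology_zero Z N d i \<longleftrightarrow> homology Z N d i = {boundaries Z N d i}"


section \<open>Free resolutions\<close>

text \<open>The augmentation \<open>C\<^sub>0 \<rightarrow> M\<close> sends the basis element number \<open>j\<close> to \<open>e j\<close>.\<close>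

definition augmentation ::
    "'r free_complex \<Rightarrow> (nat \<Rightarrow> 'm) \<Rightarrow> ('r \<Rightarrow> 'm \<Rightarrow> 'm::ab_group_add) \<Rightarrow> (nat \<Rightarrow> 'r) \<Rightarrow> 'm" where
  "augmentation C e sc z = (\<Sum>j<rk C 0. sc (z j) (e j))"

definition free_resolution ::
    "'r::comm_ring_1 free_complex \<Rightarrow> (nat \<Rightarrow> 'm) \<Rightarrow> ('r \<Rightarrow> 'm \<Rightarrow> 'm::ab_group_add) \<Rightarrow> 'm set \<Rightarrow> bool"
  where
  "free_resolution C e sc M \<longleftrightarrow>
     augmentation C e sc ` tensor_part C UNIV 0 = M \<and>
     {z \<in> tensor_part C UNIV 0. augmentation C e sc z = 0}
       = tensor_diff C (*) 1 ` tensor_part C UNIV 1 \<and>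
     (\<forall>i\<ge>1. {z \<in> tensor_part C UNIV i. tensor_diff C (*) i z = 0}
       = tensor_diff C (*) (Suc i) ` tensor_part C UNIV (Suc i))"

text \<open>
  A graded module carries a family \<open>gr\<close> of graded pieces, and \<open>a i c\<close> is the degree of the basis
  element number \<open>c\<close> of \<open>C\<^sub>i\<close>, i.e. \<open>C\<^sub>i\<close> is the direct sum of the \<open>R(- a i c)\<close>. Differentials
  and augmentation have degree \<open>0\<close>; minimality is \<open>d(C\<^sub>i) \<subseteq> \<mm> C\<^sub>i\<^sub>-\<^sub>1\<close>.
\<close>

definition minimal_graded_free_resolution ::
    "('x::finite, 'k::field) mpoly free_complex \<Rightarrow> (nat \<Rightarrow> nat \<Rightarrow> int) \<Rightarrow> (nat \<Rightarrow> 'm)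
      \<Rightarrow> (('x, 'k) mpoly \<Rightarrow> 'm \<Rightarrow> 'm::ab_group_add) \<Rightarrow> 'm set \<Rightarrow> (int \<Rightarrow> 'm set) \<Rightarrow> bool" where
  "minimal_graded_free_resolution C a e sc M gr \<longleftrightarrow>
     free_resolution C e sc M \<and>
     (\<forall>j<rk C 0. e j \<in> gr (a 0 j)) \<and>
     (\<forall>i\<ge>1. \<forall>r<rk C (i - 1). \<forall>c<rk C i. dmat C i r c \<in> hom_part (a i c - a (i - 1) r)) \<and>
     (\<forall>i\<ge>1. tensor_diff C (*) i ` tensor_part C UNIV i \<subseteq> tensor_part C max_ideal (i - 1))"


section \<open>Linearity defect and Koszul modules\<close>

text \<open>
  The component \<open>\<mm>\<^sup>p\<^sup>-\<^sup>i X\<^sub>i\<close> of \<open>\<F>\<^sup>p X\<close> in homological degree \<open>i\<close>. The truncated subtraction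
  yields \<open>X\<^sub>i\<close> for \<open>i \<ge> p\<close>.
\<close>

definition Filt :: "('x::finite, 'k::field) mpoly free_complex \<Rightarrow> nat \<Rightarrow> nat
    \<Rightarrow> (nat \<Rightarrow> ('x, 'k) mpoly) set" where
  "Filt X p i = tensor_part X (ideal_pow max_ideal (p - i)) i"

text \<open>
  The complex \<open>\<Oplus>\<^sub>p \<F>\<^sup>p X / \<F>\<^sup>p\<^sup>+\<^sup>1 X\<close> is \<open>lin_num X / lin_den X\<close>, the direct sum consisting of
  the finitely supported families \<open>u\<close> indexed by \<open>p\<close>.
\<close>

definition lin_num :: "('x::finite, 'k::field) mpoly free_complex \<Rightarrow> nat
    \<Rightarrow> (nat \<Rightarrow> nat \<Rightarrow> ('x, 'k) mpoly) set" where
  "lin_num X i = {u. finite {p. u p \<noteq> 0} \<and> (\<forall>p. u p \<in> Filt X p i)}"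

definition lin_den :: "('x::finite, 'k::field) mpoly free_complex \<Rightarrow> nat
    \<Rightarrow> (nat \<Rightarrow> nat \<Rightarrow> ('x, 'k) mpoly) set" where
  "lin_den X i = {u. finite {p. u p \<noteq> 0} \<and> (\<forall>p. u p \<in> Filt X (Suc p) i)}"

definition lin_diff :: "('x::finite, 'k::field) mpoly free_complex \<Rightarrow> nat
    \<Rightarrow> (nat \<Rightarrow> nat \<Rightarrow> ('x, 'k) mpoly) \<Rightarrow> nat \<Rightarrow> nat \<Rightarrow> ('x, 'k) mpoly" where
  "lin_diff X i u = (\<lambda>p. tensor_diff X (*) i (u p))"

text \<open>
  The zero module has the zero complex as its minimal resolution; its linearity defect is \<open>0\<close>
  because \<open>Sup {} = 0\<close> in \<^typ>\<open>enat\<close>.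
\<close>

definition linearity_defect :: "('x::finite, 'k::field) mpoly free_complex \<Rightarrow> enat" where
  "linearity_defect X =
     Sup {enat i |i. \<not> homology_zero (lin_num X) (lin_den X) (lin_diff X) i}"

text \<open>
  The minimal graded free resolution exists and is unique up to isomorphism, so that it does not
  matter which one is used here.
\<close>

definition koszul_module :: "(('x::finite, 'k::field) mpoly \<Rightarrow> 'm \<Rightarrow> 'm::ab_group_add)
    \<Rightarrow> 'm set \<Rightarrow> (int \<Rightarrow> 'm set) \<Rightarrow> bool" where
  "koszul_module sc M gr \<longleftrightarrow>
     (\<exists>X a e. minimal_graded_free_resolution X a e sc M gr \<and> linearity_defect X = 0)"


section \<open>Tor-vanishing homomorphisms\<close>

text \<open>
  The residue field \<open>k = R/\<mm>\<close>, identified with the type \<open>'k\<close>, on which a polynomial acts through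
  its constant coefficient.
\<close>

definition residue_scale :: "('x::finite, 'k::field) mpoly \<Rightarrow> 'k \<Rightarrow> 'k" where
  "residue_scale f c = Poly_Mapping.lookup f 0 * c"

text \<open>\<open>Tor\<^sub>i(k, M) = H\<^sub>i(C \<otimes> M)\<close>, where \<open>C\<close> is a free resolution of \<open>k\<close>.\<close>

definition Tor :: "'r free_complex \<Rightarrow> ('r \<Rightarrow> 'm \<Rightarrow> 'm) \<Rightarrow> 'm::ab_group_add set \<Rightarrow> nat
    \<Rightarrow> (nat \<Rightarrow> 'm) set set" where
  "Tor C sc M i = homology (tensor_part C M) (\<lambda>_. {0}) (tensor_diff C sc) i"

definition Tor_zero_class :: "'r free_complex \<Rightarrow> ('r \<Rightarrow> 'm \<Rightarrow> 'm) \<Rightarrow> 'm::ab_group_add set \<Rightarrow> nat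
    \<Rightarrow> (nat \<Rightarrow> 'm) set" where
  "Tor_zero_class C sc M i = boundaries (tensor_part C M) (\<lambda>_. {0}) (tensor_diff C sc) i"

text \<open>
  The map \<open>Tor\<^sub>i(k, \<phi>)\<close> for \<open>\<phi> : M \<rightarrow> N\<close> sends the class of \<open>z\<close> to the class of
  \<open>(id \<otimes> \<phi>)(z) = \<phi> \<circ> z\<close>; \<open>scN\<close> is the scalar multiplication of \<open>N\<close>.
\<close>

definition Tor_map :: "'r free_complex \<Rightarrow> ('r \<Rightarrow> 'n \<Rightarrow> 'n) \<Rightarrow> 'n::ab_group_add set \<Rightarrow> ('m \<Rightarrow> 'n)
    \<Rightarrow> nat \<Rightarrow> (nat \<Rightarrow> 'm) set \<Rightarrow> (nat \<Rightarrow> 'n) set" where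
  "Tor_map C scN N \<phi> i c = (\<Union>z\<in>c. (\<lambda>b. (\<phi> \<circ> z) + b) ` Tor_zero_class C scN N i)"

definition linear_map_on :: "('r \<Rightarrow> 'm \<Rightarrow> 'm) \<Rightarrow> 'm::ab_group_add set \<Rightarrow> ('r \<Rightarrow> 'n \<Rightarrow> 'n)
    \<Rightarrow> 'n::ab_group_add set \<Rightarrow> ('m \<Rightarrow> 'n) \<Rightarrow> bool" where
  "linear_map_on scM M scN N \<phi> \<longleftrightarrow>
     \<phi> ` M \<subseteq> N \<and>
     (\<forall>x\<in>M. \<forall>y\<in>M. \<phi> (x + y) = \<phi> x + \<phi> y) \<and>
     (\<forall>r. \<forall>x\<in>M. \<phi> (scM r x) = scN r (\<phi> x))"

text \<open>Whether \<open>Tor\<^sub>i(k, \<phi>) = 0\<close> does not depend on the resolution of \<open>k\<close>; all of them are allowed.\<close>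

definition tor_vanishing :: "(('x::finite, 'k::field) mpoly \<Rightarrow> 'm \<Rightarrow> 'm) \<Rightarrow> 'm::ab_group_add set
    \<Rightarrow> (('x, 'k) mpoly \<Rightarrow> 'n \<Rightarrow> 'n) \<Rightarrow> 'n::ab_group_add set \<Rightarrow> ('m \<Rightarrow> 'n) \<Rightarrow> bool" where
  "tor_vanishing scM M scN N \<phi> \<longleftrightarrow>
     linear_map_on scM M scN N \<phi> \<and>
     (\<forall>C e. free_resolution C e residue_scale (UNIV :: 'k set) \<longrightarrow>
       (\<forall>i. \<forall>c\<in>Tor C scM M i. Tor_map C scN N \<phi> i c = Tor_zero_class C scN N i))"

end

theory Submission
  imports Defs
begin

text \<open>
  Let \<open>K\<close> be the Koszul complex of the variables, a free resolution
  of \<open>k\<close>. For ideals \<open>M \<subseteq> N\<close> the inclusion is Tor-vanishing if every cycle of \<open>K \<otimes> M\<close> is a boundary of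
  \<open>K \<otimes> N\<close>, called \<open>koszul_vanishing M N\<close> below. An arbitrary resolution of \<open>k\<close> is compared with \<open>K\<close> by
  chain maps and homotopies; these are matrices over \<open>R\<close> and hence act on tensor products with ideals
  (\<open>cycles_bound_transfer\<close>).

  On \<open>K\<close> the Koszul differential \<open>d\<close> and the de Rham
  differential \<open>h\<close> satisfy \<open>d h + h d =\<close> multiplication by the total degree. In characteristic \<open>0\<close>
  a homogeneous cycle \<open>z\<close> of positive total degree therefore is \<open>d (h z)\<close> up to a nonzero scalar, and \<open>h z\<close> has entries
  in \<open>N\<close> as soon as all partial derivatives map \<open>M\<close> to \<open>N\<close>. For \<open>M = \<mm>\<^sup>p I\<^sup>n\<^sup>+\<^sup>1\<close> and \<open>N = \<mm>\<^sup>p\<^sup>+\<^sup>1 I\<^sup>n\<close> this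
  follows from the product rule and \<open>I \<subseteq> \<mm>\<^sup>2\<close> (\<open>delta_ideal_pow_prod\<close>). For monomial ideals one can work
  in a single multidegree \<open>a\<close>, choose a variable \<open>x\<^sub>j\<close> that occurs in \<open>a\<close>, and replace the partial
  derivatives by division by \<open>x\<^sub>j\<close>, which satisfies the same product rule on monomials. The two
  homotopies are instances of one with weights \<open>w j a\<close> on the variables that add up to \<open>1\<close> in every
  multidegree \<open>a \<noteq> 0\<close> (\<open>koszul_homotopy\<close>).

  If powers of \<open>I\<close> are Koszul, then since \<open>\<mm>\<^sup>p I\<^sup>n\<^sup>+\<^sup>1 \<subseteq> \<mm>\<^sup>p\<^sup>+\<^sup>2 I\<^sup>n\<close> it suffices to treat \<open>\<mm>\<^sup>q\<^sup>+\<^sup>1 P \<subseteq> \<mm>\<^sup>q P\<close> for a Koszul ideal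
  \<open>P\<close> and for \<open>P = R\<close>. For \<open>P = R\<close> this is the monomial argument. For Koszul \<open>P\<close> with minimal resolution
  \<open>Y\<close>, the acyclicity of \<open>lin Y\<close> says that boundaries in \<open>\<mm>\<^sup>a\<^sup>+\<^sup>1 Y\<^sub>j\<close> come from \<open>\<mm>\<^sup>a Y\<^sub>j\<^sub>+\<^sub>1\<close>
  (\<open>koszul_module_linear_resolution\<close>). With this, a chase through the double complex \<open>K \<otimes> Y\<close> reduces the
  claim to \<open>P = R\<close> (\<open>koszul_cycles_bound\<close>).
\<close>


section \<open>Products and powers of ideals\<close>

lemma module_mult: "module ((*) :: 'r::comm_ring_1 \<Rightarrow> 'r \<Rightarrow> 'r)"
  by unfold_locales (simp_all add: algebra_simps)

abbreviation is_ideal :: "'r::comm_ring_1 set \<Rightarrow> bool" where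
  "is_ideal \<equiv> module.subspace (*)"

lemmas is_ideal_def = module.subspace_def[OF module_mult]
  and ideal_zero = module.subspace_0[OF module_mult]
  and ideal_add = module.subspace_add[OF module_mult]
  and ideal_mult = module.subspace_scale[OF module_mult]
  and ideal_neg = module.subspace_neg[OF module_mult]
  and ideal_diff = module.subspace_diff[OF module_mult]
  and ideal_sum = module.subspace_sum[OF module_mult]
  and is_ideal_UNIV = module.subspace_UNIV[OF module_mult]

lemma ideal_mult_right: "is_ideal J \<Longrightarrow> a \<in> J \<Longrightarrow> a * r \<in> J"
  using ideal_mult[of J a r] by (simp add: mult.commute)

lemma is_ideal_ideal_span: "is_ideal (ideal_span S)"
  unfolding ideal_span_def by (rule module.subspace_span[OF module_mult])

lemma ideal_span_least: "is_ideal J \<Longrightarrow> S \<subseteq> J \<Longrightarrow> ideal_span S \<subseteq> J"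
  unfolding ideal_span_def by (rule module.span_minimal[OF module_mult])

lemma ideal_span_base: "a \<in> S \<Longrightarrow> a \<in> ideal_span S"
  unfolding ideal_span_def by (rule module.span_base[OF module_mult])

lemma is_ideal_ideal_prod: "is_ideal (ideal_prod I J)"
  unfolding ideal_prod_def by (rule is_ideal_ideal_span)

lemma ideal_prodI: "a \<in> I \<Longrightarrow> b \<in> J \<Longrightarrow> a * b \<in> ideal_prod I J"
  unfolding ideal_prod_def by (rule ideal_span_base) blast

lemma ideal_prod_least:
  "is_ideal Q \<Longrightarrow> (\<And>a b. a \<in> I \<Longrightarrow> b \<in> J \<Longrightarrow> a * b \<in> Q) \<Longrightarrow> ideal_prod I J \<subseteq> Q"
  unfolding ideal_prod_def by (rule ideal_span_least) auto

lemma ideal_prod_mono: "I \<subseteq> I' \<Longrightarrow> J \<subseteq> J' \<Longrightarrow> ideal_prod I J \<subseteq> ideal_prod I' J'"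
  by (rule ideal_prod_least[OF is_ideal_ideal_prod]) (auto intro: ideal_prodI)

lemma ideal_prod_commute: "ideal_prod I J = ideal_prod J I"
proof -
  have "ideal_prod A B \<subseteq> ideal_prod B A" for A B :: "'a set"
    by (rule ideal_prod_least[OF is_ideal_ideal_prod])
       (subst mult.commute, rule ideal_prodI)
  thus ?thesis by blast
qed

lemma is_ideal_transporter:
  assumes "is_ideal Q" shows "is_ideal {a. \<forall>b\<in>J. a * b \<in> Q}"
  using assms unfolding is_ideal_def by (auto simp: algebra_simps)

lemma ideal_prod_assoc: "ideal_prod (ideal_prod I J) K = ideal_prod I (ideal_prod J K)"
proof -
  have *: "ideal_prod (ideal_prod A B) C \<subseteq> ideal_prod A (ideal_prod B C)" for A B C :: "'a set"
  proof (rule ideal_prod_least[OF is_ideal_ideal_prod])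
    fix a c assume a: "a \<in> ideal_prod A B" and c: "c \<in> C"
    have "ideal_prod A B \<subseteq> {a. \<forall>c\<in>C. a * c \<in> ideal_prod A (ideal_prod B C)}"
      by (rule ideal_prod_least[OF is_ideal_transporter[OF is_ideal_ideal_prod]])
         (auto simp: mult.assoc intro!: ideal_prodI)
    thus "a * c \<in> ideal_prod A (ideal_prod B C)" using a c by blast
  qed
  have "ideal_prod I (ideal_prod J K) = ideal_prod (ideal_prod K J) I"
    by (metis ideal_prod_commute)
  also have "\<dots> \<subseteq> ideal_prod K (ideal_prod J I)" by (rule *)
  also have "\<dots> = ideal_prod (ideal_prod I J) K" by (metis ideal_prod_commute)
  finally show ?thesis using * by blast
qed

lemma ideal_prod_subset_right: "is_ideal J \<Longrightarrow> ideal_prod I J \<subseteq> J"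
  by (rule ideal_prod_least) (auto intro: ideal_mult)

lemma ideal_prod_UNIV: "is_ideal J \<Longrightarrow> ideal_prod UNIV J = J"
proof
  show "J \<subseteq> ideal_prod UNIV J" if "is_ideal J"
    using ideal_prodI[of 1 UNIV _ J] by auto
qed (rule ideal_prod_subset_right)

lemma is_ideal_ideal_pow: "is_ideal (ideal_pow I n)"
  by (cases n) (simp_all add: is_ideal_ideal_prod is_ideal_UNIV)

lemma ideal_pow_add: "ideal_pow I (m + n) = ideal_prod (ideal_pow I m) (ideal_pow I n)"
  by (induction m) (simp_all add: ideal_prod_UNIV is_ideal_ideal_pow ideal_prod_assoc)

lemma ideal_pow_one: "is_ideal I \<Longrightarrow> ideal_pow I (Suc 0) = I"
  by (simp add: ideal_prod_commute[of I] ideal_prod_UNIV)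

lemma ideal_pow_antimono: "m \<le> n \<Longrightarrow> ideal_pow I n \<subseteq> ideal_pow I m"
  using ideal_pow_add[of I "n - m" m]
  by (simp add: ideal_prod_subset_right is_ideal_ideal_pow)

text \<open>One factor \<open>I\<close> of \<open>I\<^sup>n\<^sup>+\<^sup>1\<close> is traded for \<open>J\<^sup>2\<close>.\<close>
lemma ideal_prod_pow_Suc_subset:
  assumes "I \<subseteq> ideal_pow J 2"
  shows "ideal_prod (ideal_pow J p) (ideal_pow I (Suc n))
    \<subseteq> ideal_prod (ideal_pow J (p + 2)) (ideal_pow I n)"
proof -
  have "ideal_prod (ideal_pow J p) (ideal_pow I (Suc n))
      = ideal_prod (ideal_prod (ideal_pow J p) I) (ideal_pow I n)"
    by (simp add: ideal_prod_assoc)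
  also have "\<dots> \<subseteq> ideal_prod (ideal_pow J (p + 2)) (ideal_pow I n)"
    unfolding ideal_pow_add by (intro ideal_prod_mono order_refl assms)
  finally show ?thesis .
qed


section \<open>Ideals generated by elements of a prescribed kind\<close>

inductive_set finite_sums :: "'a::monoid_add set \<Rightarrow> 'a set" for A where
  zero: "0 \<in> finite_sums A"
| add: "a \<in> A \<Longrightarrow> b \<in> finite_sums A \<Longrightarrow> a + b \<in> finite_sums A"

lemma finite_sums_base: "a \<in> A \<Longrightarrow> a \<in> finite_sums A"
  using finite_sums.add[OF _ finite_sums.zero] by fastforce

lemma finite_sums_add: "a \<in> finite_sums A \<Longrightarrow> b \<in> finite_sums A \<Longrightarrow> a + b \<in> finite_sums A"
  by (induction rule: finite_sums.induct) (auto simp: add.assoc intro: finite_sums.add)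

lemma finite_sums_sum:
  "(\<And>i. i \<in> F \<Longrightarrow> f i \<in> finite_sums A) \<Longrightarrow> sum f F \<in> finite_sums (A :: 'a::comm_monoid_add set)"
  by (induction F rule: infinite_finite_induct) (auto intro: finite_sums.zero finite_sums_add)

lemma finite_sums_image:
  assumes "a \<in> finite_sums A" "\<phi> 0 = 0" "\<And>x y. \<phi> (x + y) = \<phi> x + \<phi> y"
    and "\<And>x. x \<in> A \<Longrightarrow> \<phi> x \<in> finite_sums B"
  shows "\<phi> a \<in> finite_sums B"
  using assms(1) by induction (auto simp: assms(2-4) finite_sums.zero finite_sums_add)

lemma finite_sums_mult:
  assumes "a \<in> finite_sums A" "b \<in> finite_sums B"
  shows "a * b \<in> finite_sums {x * y |x y. x \<in> A \<and> y \<in> (B :: 'a::comm_ring_1 set)}"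
proof (rule finite_sums_image[OF assms(1), of "\<lambda>a. a * b"])
  fix x assume "x \<in> A"
  show "x * b \<in> finite_sums {x * y |x y. x \<in> A \<and> y \<in> B}"
    by (rule finite_sums_image[OF assms(2), of "\<lambda>b. x * b"])
       (use \<open>x \<in> A\<close> in \<open>auto simp: distrib_left intro!: finite_sums_base\<close>)
qed (simp_all add: algebra_simps)

text \<open>
  With \<open>G\<close> the set of homogeneous polynomials, or the set of terms, the following says that the
  ideal \<open>P\<close> is homogeneous, or monomial. Generation by sums instead of linear combinations is the
  point: an additive operator is controlled on all of \<open>P\<close> by its values on \<open>P \<inter> G\<close>.
\<close>

definition sum_generated :: "'r::comm_ring_1 set \<Rightarrow> 'r set \<Rightarrow> bool" where
  "sum_generated G P \<longleftrightarrow> is_ideal P \<and> P \<subseteq> finite_sums (P \<inter> G)"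

text \<open>
  The common features of a derivation (where \<open>\<alpha> = \<beta> = 1\<close>) and of the operator that divides by a
  variable those monomials that it divides and kills the others, on terms (where one of \<open>\<alpha>\<close> and \<open>\<beta>\<close>
  is \<open>0\<close>).
\<close>

locale leibniz_operator =
  fixes G :: "'r::comm_ring_1 set" and \<delta> :: "'r \<Rightarrow> 'r"
  assumes mult_closed: "f \<in> G \<Longrightarrow> g \<in> G \<Longrightarrow> f * g \<in> G"
    and all_sums: "UNIV \<subseteq> finite_sums G"
    and delta_add: "\<delta> (f + g) = \<delta> f + \<delta> g"
    and leibniz: "f \<in> G \<Longrightarrow> g \<in> G \<Longrightarrow> \<exists>\<alpha> \<beta>. \<delta> (f * g) = \<alpha> * (\<delta> f * g) + \<beta> * (f * \<delta> g)"
begin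

lemma delta_zero: "\<delta> 0 = 0"
  using delta_add[of 0 0] by simp

lemma sum_generated_UNIV: "sum_generated G UNIV"
  using all_sums by (simp add: sum_generated_def is_ideal_UNIV)

text \<open>
  A combination \<open>\<Sum> c s\<close> with \<open>s \<in> S\<close> becomes a sum of elements of \<open>G\<close> when each coefficient \<open>c\<close>
  is split into elements of \<open>G\<close>.
\<close>
lemma sum_generated_ideal_span:
  assumes "S \<subseteq> G" shows "sum_generated G (ideal_span S)"
proof -
  have "f \<in> finite_sums (ideal_span S \<inter> G)" if "f \<in> ideal_span S" for f
    using that[unfolded ideal_span_def]
  proof (induction rule: module.span_induct_alt[OF module_mult, consumes 1, case_names base step])
    case base show ?case by (rule finite_sums.zero)
  next
    case (step c s y)
    have "c * s \<in> finite_sums (ideal_span S \<inter> G)"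
    proof (rule finite_sums_image[of c G "\<lambda>c. c * s"])
      show "c \<in> finite_sums G" using all_sums by auto
      show "x * s \<in> finite_sums (ideal_span S \<inter> G)" if "x \<in> G" for x
        using that step(1) assms
        by (intro finite_sums_base IntI mult_closed ideal_mult[OF is_ideal_ideal_span]
            ideal_span_base) auto
    qed (simp_all add: algebra_simps)
    thus ?case using step(2) by (rule finite_sums_add)
  qed
  thus ?thesis by (auto simp: sum_generated_def is_ideal_ideal_span)
qed

lemma sum_generated_ideal_prod:
  assumes P: "sum_generated G P" and Q: "sum_generated G Q"
  shows "sum_generated G (ideal_prod P Q)"
    and "ideal_prod P Q \<subseteq> finite_sums {x * y |x y. x \<in> P \<inter> G \<and> y \<in> Q \<inter> G}"
proof -
  let ?X = "{x * y |x y. x \<in> P \<inter> G \<and> y \<in> Q \<inter> G}"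
  show *: "ideal_prod P Q \<subseteq> finite_sums ?X"
  proof
    fix f assume "f \<in> ideal_prod P Q"
    thus "f \<in> finite_sums ?X" unfolding ideal_prod_def ideal_span_def
    proof (induction rule: module.span_induct_alt[OF module_mult, consumes 1, case_names base step])
      case base show ?case by (rule finite_sums.zero)
    next
      case (step c s y)
      then obtain a b where ab: "s = a * b" "a \<in> P" "b \<in> Q" by auto
      have "c * a \<in> P" using ab P by (auto simp: sum_generated_def intro: ideal_mult)
      hence "(c * a) * b \<in> finite_sums ?X"
        using ab P Q by (intro finite_sums_mult) (auto simp: sum_generated_def)
      thus ?case using step(2) by (simp add: ab mult.assoc finite_sums_add)
    qed
  qed
  have "finite_sums ?X \<subseteq> finite_sums (ideal_prod P Q \<inter> G)"
  proof
    fix f assume "f \<in> finite_sums ?X"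
    thus "f \<in> finite_sums (ideal_prod P Q \<inter> G)"
      by (rule finite_sums_image[of f ?X "\<lambda>f. f"])
         (auto intro!: finite_sums_base ideal_prodI mult_closed)
  qed
  thus "sum_generated G (ideal_prod P Q)"
    using * by (auto simp: sum_generated_def is_ideal_ideal_prod)
qed

lemma sum_generated_ideal_pow: "sum_generated G P \<Longrightarrow> sum_generated G (ideal_pow P n)"
  by (induction n) (simp_all add: sum_generated_UNIV sum_generated_ideal_prod)

lemma delta_in_ideal:
  assumes "f \<in> finite_sums A" "is_ideal Q" "\<And>a. a \<in> A \<Longrightarrow> \<delta> a \<in> Q"
  shows "\<delta> f \<in> Q"
  using assms(1) by induction (auto simp: delta_zero delta_add assms(2,3) ideal_zero ideal_add)

lemma delta_ideal_prod:
  assumes P: "sum_generated G P1" "sum_generated G P2"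
    and \<delta>: "\<delta> ` P1 \<subseteq> Q1" "\<delta> ` P2 \<subseteq> Q2"
    and Q: "is_ideal Q" "ideal_prod Q1 P2 \<subseteq> Q" "ideal_prod P1 Q2 \<subseteq> Q"
  shows "\<delta> ` ideal_prod P1 P2 \<subseteq> Q"
proof -
  have "\<delta> f \<in> Q" if "f \<in> ideal_prod P1 P2" for f
  proof (rule delta_in_ideal[OF _ Q(1)])
    show "f \<in> finite_sums {x * y |x y. x \<in> P1 \<inter> G \<and> y \<in> P2 \<inter> G}"
      using sum_generated_ideal_prod(2)[OF P] that by blast
  next
    fix a assume "a \<in> {x * y |x y. x \<in> P1 \<inter> G \<and> y \<in> P2 \<inter> G}"
    then obtain x y where xy: "a = x * y" "x \<in> P1" "x \<in> G" "y \<in> P2" "y \<in> G" by auto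
    then obtain \<alpha> \<beta> where "\<delta> a = \<alpha> * (\<delta> x * y) + \<beta> * (x * \<delta> y)" using leibniz by blast
    moreover have "\<delta> x * y \<in> Q"
      using \<delta>(1) xy by (intro subsetD[OF Q(2)] ideal_prodI) auto
    moreover have "x * \<delta> y \<in> Q"
      using \<delta>(2) xy by (intro subsetD[OF Q(3)] ideal_prodI) auto
    ultimately show "\<delta> a \<in> Q" using Q(1) by (auto intro: ideal_add ideal_mult)
  qed
  thus ?thesis by blast
qed

lemma delta_ideal_pow:
  assumes "sum_generated G J"
  shows "\<delta> ` ideal_pow J p \<subseteq> ideal_pow J (p - 1)"
proof (induction p)
  case (Suc p)
  show ?case unfolding ideal_pow.simps diff_Suc_1
  proof (rule delta_ideal_prod[OF assms sum_generated_ideal_pow[OF assms] subset_UNIV Suc])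
    show "ideal_prod J (ideal_pow J (p - 1)) \<subseteq> ideal_pow J p" by (cases p) simp_all
  qed (simp_all add: is_ideal_ideal_pow ideal_prod_UNIV)
qed simp

text \<open>
  By the product rule, \<open>\<delta>\<close> takes one factor \<open>J\<close> off \<open>J\<^sup>p\<close>, which \<open>I \<subseteq> J\<^sup>2\<close> repays twofold, or it turns
  one factor \<open>I\<close> into \<open>J\<close>.
\<close>

lemma delta_ideal_pow_prod:
  assumes J: "sum_generated G J" and I: "sum_generated G I" and IJ: "I \<subseteq> ideal_pow J 2"
  shows "\<delta> ` ideal_prod (ideal_pow J p) (ideal_pow I (Suc n))
    \<subseteq> ideal_prod (ideal_pow J (Suc p)) (ideal_pow I n)"
proof -
  have isJ: "is_ideal J" using J by (simp add: sum_generated_def)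
  have "\<delta> ` ideal_pow J 2 \<subseteq> J"
    using delta_ideal_pow[OF J, of 2] ideal_pow_one[OF isJ] by simp
  hence \<delta>I: "\<delta> ` I \<subseteq> J" using IJ by blast
  have pow: "\<delta> ` ideal_pow I (Suc n) \<subseteq> ideal_prod J (ideal_pow I n)" for n
  proof (induction n)
    case 0
    show ?case
      using \<delta>I I by (simp add: ideal_prod_commute[of _ UNIV] ideal_prod_UNIV isJ sum_generated_def)
  next
    case (Suc n)
    show ?case
    proof (subst ideal_pow.simps(2), rule delta_ideal_prod[OF I sum_generated_ideal_pow[OF I] \<delta>I Suc])
      have "ideal_prod I (ideal_prod J (ideal_pow I n)) = ideal_prod J (ideal_pow I (Suc n))"
        by (simp add: ideal_prod_assoc[symmetric] ideal_prod_commute[of I J])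
      thus "ideal_prod I (ideal_prod J (ideal_pow I n)) \<subseteq> ideal_prod J (ideal_pow I (Suc n))" by simp
    qed (simp_all add: is_ideal_ideal_prod)
  qed
  show ?thesis
  proof (rule delta_ideal_prod[OF sum_generated_ideal_pow[OF J] sum_generated_ideal_pow[OF I]
        delta_ideal_pow[OF J] pow])
    have "ideal_prod (ideal_pow J (p - 1)) (ideal_pow I (Suc n))
        \<subseteq> ideal_prod (ideal_pow J (p - 1 + 2)) (ideal_pow I n)"
      by (rule ideal_prod_pow_Suc_subset[OF IJ])
    also have "\<dots> \<subseteq> ideal_prod (ideal_pow J (Suc p)) (ideal_pow I n)"
      by (rule ideal_prod_mono[OF ideal_pow_antimono order_refl]) linarith
    finally show "ideal_prod (ideal_pow J (p - 1)) (ideal_pow I (Suc n))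
        \<subseteq> ideal_prod (ideal_pow J (Suc p)) (ideal_pow I n)" .
    have "ideal_prod (ideal_pow J p) (ideal_prod J (ideal_pow I n))
        = ideal_prod (ideal_pow J (Suc p)) (ideal_pow I n)"
      by (simp add: ideal_prod_assoc[symmetric] ideal_prod_commute[of _ J])
    thus "ideal_prod (ideal_pow J p) (ideal_prod J (ideal_pow I n))
        \<subseteq> ideal_prod (ideal_pow J (Suc p)) (ideal_pow I n)" by simp
  qed (rule is_ideal_ideal_prod)
qed

end

section \<open>Lowering exponents in polynomials\<close>

definition unit_exp :: "'x \<Rightarrow> 'x \<Rightarrow>\<^sub>0 nat" where
  "unit_exp j = Poly_Mapping.single j 1"

lemma lookup_unit_exp: "Poly_Mapping.lookup (unit_exp j) i = (1 when j = i)"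
  by (simp add: unit_exp_def lookup_single)

abbreviation var :: "'x \<Rightarrow> ('x, 'k::field) mpoly" where
  "var j \<equiv> Poly_Mapping.single (unit_exp j) 1"

text \<open>
  The term \<open>v x\<^sup>b\<close> goes to \<open>w(b - e\<^sub>j) v x\<^sup>b / x\<^sub>j\<close>, or to \<open>0\<close> if \<open>x\<^sub>j\<close> does not divide \<open>x\<^sup>b\<close>. Partial
  derivatives, division by \<open>x\<^sub>j\<close> where possible, and the components of the Koszul homotopies are
  all of this form; they differ in the weight \<open>w\<close> only.
\<close>
definition lower :: "'x \<Rightarrow> (('x \<Rightarrow>\<^sub>0 nat) \<Rightarrow> 'k) \<Rightarrow> ('x, 'k::field) mpoly \<Rightarrow> ('x, 'k) mpoly" where
  "lower j w f = Poly_Mapping.mapp (\<lambda>c v. w c * v) (Poly_Mapping.map_key (\<lambda>c. c + unit_exp j) f)"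

lemma lookup_lower:
  "Poly_Mapping.lookup (lower j w f) c = w c * Poly_Mapping.lookup f (c + unit_exp j)"
proof -
  have "inj (\<lambda>c. c + unit_exp j)" by (simp add: inj_def)
  hence "Poly_Mapping.lookup (Poly_Mapping.map_key (\<lambda>c. c + unit_exp j) f) c
      = Poly_Mapping.lookup f (c + unit_exp j)" by (simp add: map_key.rep_eq)
  thus ?thesis by (simp add: lower_def lookup_mapp when_def not_in_keys_iff_lookup_eq_zero)
qed

lemma exp_eq_add_unit_iff:
  fixes c :: "'x \<Rightarrow>\<^sub>0 nat"
  shows "c = unit_exp j + q \<longleftrightarrow> Poly_Mapping.lookup c j \<noteq> 0 \<and> q = c - unit_exp j"
proof
  assume *: "Poly_Mapping.lookup c j \<noteq> 0 \<and> q = c - unit_exp j"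
  show "c = unit_exp j + q"
  proof (rule poly_mapping_eqI)
    fix i show "Poly_Mapping.lookup c i = Poly_Mapping.lookup (unit_exp j + q) i"
      using * by (cases "i = j") (auto simp: lookup_add lookup_minus lookup_unit_exp when_def)
  qed
qed (simp add: lookup_add lookup_unit_exp)

lemma diff_unit_add:
  "Poly_Mapping.lookup c j \<noteq> 0 \<Longrightarrow> c - unit_exp j + unit_exp j = (c :: 'x \<Rightarrow>\<^sub>0 nat)"
  using exp_eq_add_unit_iff[of c j "c - unit_exp j"] by (simp add: add.commute)

lemma lookup_var_mult:
  "Poly_Mapping.lookup (var j * f) c
    = (if Poly_Mapping.lookup c j = 0 then 0 else Poly_Mapping.lookup f (c - unit_exp j))"
proof -
  have "Poly_Mapping.lookup (var j * f) c
      = (\<Sum>l. (1 when unit_exp j = l) * (\<Sum>q. Poly_Mapping.lookup f q when c = l + q))"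
    by (simp add: lookup_mult lookup_single)
  also have "\<dots> = (\<Sum>l. (\<Sum>q. Poly_Mapping.lookup f q when c = l + q) when unit_exp j = l)"
    by (simp add: when_mult)
  also have "\<dots> = (\<Sum>q. Poly_Mapping.lookup f q when c = unit_exp j + q)"
    by (rule Sum_any_when_equal')
  also have "\<dots> = (if Poly_Mapping.lookup c j = 0 then 0 else Poly_Mapping.lookup f (c - unit_exp j))"
    unfolding exp_eq_add_unit_iff by auto
  finally show ?thesis .
qed

lemma lower_add: "lower j w (f + g) = lower j w f + lower j w g"
  by (rule poly_mapping_eqI) (simp add: lookup_lower lookup_add algebra_simps)

lemma lower_zero: "lower j w 0 = 0"
  by (rule poly_mapping_eqI) (simp add: lookup_lower)

lemma lower_uminus: "lower j w (- f) = - lower j w f"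
  by (rule poly_mapping_eqI) (simp add: lookup_lower)

lemma lower_sum: "lower j w (sum f A) = (\<Sum>i\<in>A. lower j w (f i))"
  by (induction A rule: infinite_finite_induct) (simp_all add: lower_zero lower_add)

lemma lower_single:
  "lower j w (Poly_Mapping.single b v)
    = (if Poly_Mapping.lookup b j = 0 then 0
       else Poly_Mapping.single (b - unit_exp j) (w (b - unit_exp j) * v))"
proof (rule poly_mapping_eqI)
  fix c
  have "b = c + unit_exp j \<longleftrightarrow> Poly_Mapping.lookup b j \<noteq> 0 \<and> c = b - unit_exp j"
    using exp_eq_add_unit_iff[of b j c] by (simp add: add.commute)
  thus "Poly_Mapping.lookup (lower j w (Poly_Mapping.single b v)) c
      = Poly_Mapping.lookup (if Poly_Mapping.lookup b j = 0 then 0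
       else Poly_Mapping.single (b - unit_exp j) (w (b - unit_exp j) * v)) c"
    by (auto simp: lookup_lower lookup_single when_def)
qed

definition terms :: "('x, 'k::field) mpoly set" where
  "terms = {Poly_Mapping.single b v |b v. True}"

definition homogeneous_elements :: "('x::finite, 'k::field) mpoly set" where
  "homogeneous_elements = {f. \<exists>d. \<forall>b\<in>Poly_Mapping.keys f. mdeg b = d}"

lemma mpoly_sum_of_terms:
  "f = (\<Sum>b\<in>Poly_Mapping.keys f. Poly_Mapping.single b (Poly_Mapping.lookup f b))"
proof (rule poly_mapping_eqI)
  fix c
  show "Poly_Mapping.lookup f c
    = Poly_Mapping.lookup (\<Sum>b\<in>Poly_Mapping.keys f. Poly_Mapping.single b (Poly_Mapping.lookup f b)) c"
    by (simp add: lookup_sum lookup_single when_def not_in_keys_iff_lookup_eq_zero)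
qed

lemma UNIV_finite_sums_terms: "UNIV \<subseteq> finite_sums terms"
proof
  fix f :: "('a, 'b) mpoly"
  show "f \<in> finite_sums terms"
    by (subst mpoly_sum_of_terms, rule finite_sums_sum, rule finite_sums_base) (auto simp: terms_def)
qed

lemma finite_sums_mono: "A \<subseteq> B \<Longrightarrow> finite_sums A \<subseteq> finite_sums B"
proof
  show "f \<in> finite_sums B" if "A \<subseteq> B" "f \<in> finite_sums A" for f
    using that(2,1) by induction (auto intro: finite_sums.intros)
qed

lemma mdeg_add: "mdeg (a + b) = mdeg a + mdeg b"
  by (simp add: mdeg_def lookup_add sum.distrib)

lemma terms_subset_homogeneous_elements: "terms \<subseteq> homogeneous_elements"
  by (auto simp: terms_def homogeneous_elements_def)

lemma homogeneous_elements_mult: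
  assumes "f \<in> homogeneous_elements" "g \<in> homogeneous_elements"
  shows "f * g \<in> homogeneous_elements"
proof -
  obtain d e where "\<forall>b\<in>Poly_Mapping.keys f. mdeg b = d" "\<forall>b\<in>Poly_Mapping.keys g. mdeg b = e"
    using assms by (auto simp: homogeneous_elements_def)
  hence "\<forall>b\<in>Poly_Mapping.keys (f * g). mdeg b = d + e"
    using keys_mult[of f g] by (fastforce simp: mdeg_add)
  thus ?thesis by (auto simp: homogeneous_elements_def)
qed

definition partial :: "'x \<Rightarrow> ('x, 'k::field) mpoly \<Rightarrow> ('x, 'k) mpoly" where
  "partial j = lower j (\<lambda>c. of_nat (Poly_Mapping.lookup c j + 1))"

lemma lookup_partial:
  "Poly_Mapping.lookup (partial j f) c
    = of_nat (Poly_Mapping.lookup c j + 1) * Poly_Mapping.lookup f (c + unit_exp j)"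
  by (simp add: partial_def lookup_lower)

lemma partial_add: "partial j (f + g) = partial j f + partial j g"
  by (simp add: partial_def lower_add)

lemma partial_zero: "partial j 0 = 0"
  by (simp add: partial_def lower_zero)

lemma partial_single:
  "partial j (Poly_Mapping.single b v)
    = Poly_Mapping.single (b - unit_exp j) (of_nat (Poly_Mapping.lookup b j) * v)"
proof (cases "Poly_Mapping.lookup b j")
  case (Suc n)
  hence "Poly_Mapping.lookup (b - unit_exp j) j + 1 = Poly_Mapping.lookup b j"
    by (simp add: lookup_minus lookup_unit_exp)
  thus ?thesis using Suc unfolding partial_def by (simp only: lower_single) simp
qed (simp add: partial_def lower_single)

lemma add_diff_unit:
  fixes a :: "'x \<Rightarrow>\<^sub>0 nat"
  assumes "Poly_Mapping.lookup a j \<noteq> 0"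
  shows "a + b - unit_exp j = a - unit_exp j + b"
  by (rule poly_mapping_eqI, rename_tac i, case_tac "i = j")
     (use assms in \<open>auto simp: lookup_add lookup_minus lookup_unit_exp when_def\<close>)

lemma partial_mult: "partial j (f * g) = partial j f * g + f * partial j g"
proof -
  let ?P = "\<lambda>f g. partial j (f * g) = partial j f * g + f * partial j g"
  have 1: "?P (Poly_Mapping.single a u) (Poly_Mapping.single b v)" for a b and u v :: 'b
  proof -
    have "Poly_Mapping.single (a + b - unit_exp j) (of_nat (Poly_Mapping.lookup a j) * (u * v))
        = Poly_Mapping.single (a - unit_exp j + b) (of_nat (Poly_Mapping.lookup a j) * (u * v))"
      by (cases "Poly_Mapping.lookup a j = 0") (simp_all add: add_diff_unit)
    moreover
    have "Poly_Mapping.single (a + b - unit_exp j) (of_nat (Poly_Mapping.lookup b j) * (u * v))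
        = Poly_Mapping.single (a + (b - unit_exp j)) (of_nat (Poly_Mapping.lookup b j) * (u * v))"
      using add_diff_unit[of b j a]
      by (cases "Poly_Mapping.lookup b j = 0") (simp_all add: add.commute)
    ultimately show ?thesis
      unfolding mult_single partial_single
      by (simp add: lookup_add single_add algebra_simps)
  qed
  have 2: "?P f (Poly_Mapping.single b v)" if "f \<in> finite_sums terms" for f b and v :: 'b
    using that
  proof induction
    case (add a f)
    thus ?case using 1 by (auto simp: terms_def partial_add algebra_simps)
  qed (simp add: partial_zero)
  have "?P f g" if "g \<in> finite_sums terms" for g
    using that
  proof induction
    case (add a g)
    moreover have "f \<in> finite_sums terms" using UNIV_finite_sums_terms by auto
    ultimately show ?case using 2 by (auto simp: terms_def partial_add algebra_simps)
  qed (simp add: partial_zero)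
  thus ?thesis using UNIV_finite_sums_terms by auto
qed

lemma leibniz_operator_partial: "leibniz_operator homogeneous_elements (partial j)"
proof
  show "UNIV \<subseteq> finite_sums homogeneous_elements"
    using UNIV_finite_sums_terms finite_sums_mono[OF terms_subset_homogeneous_elements] by blast
  show "\<exists>\<alpha> \<beta>. partial j (f * g) = \<alpha> * (partial j f * g) + \<beta> * (f * partial j g)"
    for f g :: "('a, 'b) mpoly" by (rule exI[of _ 1], rule exI[of _ 1]) (simp add: partial_mult)
qed (simp_all add: partial_add homogeneous_elements_mult)

abbreviation strip :: "'x \<Rightarrow> ('x, 'k::field) mpoly \<Rightarrow> ('x, 'k) mpoly" where
  "strip j \<equiv> lower j (\<lambda>_. 1)"

lemma leibniz_operator_strip: "leibniz_operator terms (strip j)"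
proof
  fix f g :: "('a, 'b) mpoly" assume "f \<in> terms" "g \<in> terms"
  then obtain a u b v where fg: "f = Poly_Mapping.single a u" "g = Poly_Mapping.single b v"
    by (auto simp: terms_def)
  show "f * g \<in> terms" by (auto simp: fg mult_single terms_def)
  consider "Poly_Mapping.lookup a j \<noteq> 0" | "Poly_Mapping.lookup b j \<noteq> 0"
    | "Poly_Mapping.lookup a j = 0" "Poly_Mapping.lookup b j = 0" by blast
  thus "\<exists>\<alpha> \<beta>. strip j (f * g) = \<alpha> * (strip j f * g) + \<beta> * (f * strip j g)"
  proof cases
    case 1
    hence "strip j (f * g) = 1 * (strip j f * g) + 0 * (f * strip j g)"
      by (simp add: fg mult_single lower_single lookup_add add_diff_unit)
    thus ?thesis by blast
  next
    case 2
    hence "strip j (f * g) = 0 * (strip j f * g) + 1 * (f * strip j g)"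
      using add_diff_unit[of b j a]
      by (simp add: fg mult_single lower_single lookup_add add.commute)
    thus ?thesis by blast
  next
    case 3
    hence "strip j (f * g) = 0 * (strip j f * g) + 0 * (f * strip j g)"
      by (simp add: fg mult_single lower_single lookup_add)
    thus ?thesis by blast
  qed
qed (use UNIV_finite_sums_terms in \<open>simp_all add: lower_add\<close>)

lemma sum_generated_max_ideal:
  assumes "terms \<subseteq> G" "leibniz_operator G \<delta>" shows "sum_generated G max_ideal"
  unfolding max_ideal_def using assms(1)
  by (intro leibniz_operator.sum_generated_ideal_span[OF assms(2)]) (auto simp: terms_def)

section \<open>The Koszul complex and its contracting homotopies\<close>

definition below :: "'x::finite \<Rightarrow> 'x set \<Rightarrow> 'x set" where
  "below j S = {l \<in> S. to_nat l < to_nat j}"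

text \<open>
  The sign in \<open>e\<^sub>j \<and> e\<^sub>S = \<plusminus> e\<^sub>S\<^sub>\<union>\<^sub>j\<close>, where the factors of \<open>e\<^sub>S\<close> are ordered by an enumeration of the
  variables.
\<close>
definition sgn_ins :: "'x::finite \<Rightarrow> 'x set \<Rightarrow> 'r::comm_ring_1" where
  "sgn_ins j S = (-1) ^ card (below j S)"

lemma sgn_ins_square: "sgn_ins j S * sgn_ins j S = 1"
  by (simp add: sgn_ins_def flip: power_add mult_2)

lemma sgn_ins_insert:
  assumes "l \<notin> S" "l \<noteq> j"
  shows "sgn_ins j (insert l S) = (if to_nat l < to_nat j then - sgn_ins j S else sgn_ins j S)"
proof -
  have "below j (insert l S) = (if to_nat l < to_nat j then insert l (below j S) else below j S)"
    by (auto simp: below_def)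
  moreover have "l \<notin> below j S" using assms by (simp add: below_def)
  ultimately show ?thesis by (simp add: sgn_ins_def)
qed

lemma sgn_ins_remove_anticommute:
  assumes "j \<notin> S" "l \<in> S"
  shows "sgn_ins j S * sgn_ins l (insert j S - {l})
    = - (sgn_ins l (S - {l}) * sgn_ins j (S - {l}) :: 'r::comm_ring_1)"
proof -
  define T where "T = S - {l}"
  have S: "S = insert l T" "insert j S - {l} = insert j T" "l \<notin> T" "j \<notin> T" "j \<noteq> l"
    using assms by (auto simp: T_def)
  have S': "insert j (insert l T) - {l} = insert j T" using S by auto
  have "to_nat l \<noteq> to_nat j" using S(5) by simp
  thus ?thesis unfolding T_def[symmetric] S(1)
    using S(3-5) by (auto simp: sgn_ins_insert S')
qed

lemma sgn_ins_insert_anticommute: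
  assumes "j \<notin> S" "l \<notin> S" "j \<noteq> l"
  shows "sgn_ins j S * sgn_ins l (insert j S) = - (sgn_ins l S * sgn_ins j (insert l S))"
proof -
  have "to_nat l \<noteq> to_nat j" using assms(3) by simp
  thus ?thesis using assms by (auto simp: sgn_ins_insert)
qed

lemma lower_sgn_ins: "lower j w (sgn_ins l S * f) = sgn_ins l S * lower j w f"
  by (cases "even (card (below l S))") (simp_all add: sgn_ins_def lower_uminus)

text \<open>
  A function on sets \<open>S\<close> of variables stands for \<open>\<Sum>\<^sub>S z(S) e\<^sub>S\<close>, all homological degrees \<open>card S\<close>
  being treated at once.
\<close>
definition kdiff :: "('x::finite set \<Rightarrow> ('x, 'k::field) mpoly) \<Rightarrow> 'x set \<Rightarrow> ('x, 'k) mpoly" where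
  "kdiff z S = (\<Sum>j\<in>-S. sgn_ins j S * (var j * z (insert j S)))"

lemma kdiff_kdiff: "kdiff (kdiff z) = 0"
proof
  fix S :: "'a set"
  define f where "f j l = sgn_ins j S * sgn_ins l (insert j S) *
    (var j * var l * z (insert l (insert j S)))" for j l
  have anti: "f j l = - f l j" if "j \<notin> S" "l \<notin> S" "j \<noteq> l" for j l
    unfolding f_def sgn_ins_insert_anticommute[OF that]
    by (simp add: insert_commute mult.commute mult.left_commute)
  define A where "A = {(j, l). j \<notin> S \<and> l \<notin> S \<and> to_nat j < to_nat l}"
  define B where "B = {(j, l). j \<notin> S \<and> l \<notin> S \<and> to_nat l < to_nat j}"
  \<comment> \<open>Splitting by the order of the pair, instead of halving, also works in characteristic \<open>2\<close>.\<close>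
  have AB: "Sigma (-S) (\<lambda>j. - insert j S) = A \<union> B" "A \<inter> B = {}"
    by (auto simp: A_def B_def) (metis linorder_neqE_nat to_nat_split)
  have "kdiff (kdiff z) S = (\<Sum>j\<in>-S. \<Sum>l\<in>- insert j S. f j l)"
    by (simp add: kdiff_def f_def sum_distrib_left mult.assoc mult.left_commute)
  also have "\<dots> = (\<Sum>(j, l)\<in>A \<union> B. f j l)"
    by (simp add: sum.Sigma AB(1) del: Compl_insert)
  also have "\<dots> = (\<Sum>(j, l)\<in>A. f j l) + (\<Sum>(j, l)\<in>B. f j l)"
    by (rule sum.union_disjoint) (simp_all add: AB(2))
  also have "(\<Sum>(j, l)\<in>B. f j l) = (\<Sum>(j, l)\<in>A. f l j)"
    by (rule sum.reindex_bij_witness[of _ prod.swap prod.swap]) (auto simp: A_def B_def)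
  also have "\<dots> = (\<Sum>(j, l)\<in>A. - f j l)"
    by (rule sum.cong) (auto simp: A_def intro: anti)
  finally show "kdiff (kdiff z) S = 0 S" by (simp add: split_def sum_negf)
qed

text \<open>
  The generator \<open>e\<^sub>S\<close> of the Koszul complex has the multidegree \<open>set_exp S\<close>, so that \<open>x\<^sup>c e\<^sub>S\<close> has the
  multidegree \<open>c + set_exp S\<close>; the differential preserves multidegrees.
\<close>
definition set_exp :: "'x::finite set \<Rightarrow> 'x \<Rightarrow>\<^sub>0 nat" where
  "set_exp S = (\<Sum>i\<in>S. unit_exp i)"

lemma lookup_set_exp: "Poly_Mapping.lookup (set_exp S) i = (if i \<in> S then 1 else 0)"
  by (simp add: set_exp_def lookup_sum lookup_unit_exp when_def)

lemma set_exp_insert: "j \<notin> S \<Longrightarrow> set_exp (insert j S) = unit_exp j + set_exp S"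
  by (simp add: set_exp_def)

lemma set_exp_remove: "l \<in> S \<Longrightarrow> unit_exp l + set_exp (S - {l}) = set_exp S"
  using set_exp_insert[of l "S - {l}"] by (simp add: insert_absorb)

lemma mdeg_set_exp: "mdeg (set_exp S) = card S"
  by (simp add: mdeg_def lookup_set_exp sum.If_cases)

text \<open>
  The component \<open>e\<^sub>S \<mapsto> e\<^sub>j \<and> e\<^sub>S\<close> of a homotopy. The weight \<open>w j\<close> is evaluated at the multidegree of
  the element that the homotopy is applied to, which is \<open>c + e\<^sub>j + set_exp S\<close> if the resulting
  coefficient monomial is \<open>x\<^sup>c\<close>.
\<close>
definition wlower ::
    "('x::finite \<Rightarrow> ('x \<Rightarrow>\<^sub>0 nat) \<Rightarrow> 'k::field) \<Rightarrow> 'x \<Rightarrow> 'x set \<Rightarrow> ('x, 'k) mpoly \<Rightarrow> ('x, 'k) mpoly" where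
  "wlower w j S = lower j (\<lambda>c. w j (c + unit_exp j + set_exp S))"

definition khom :: "('x::finite \<Rightarrow> ('x \<Rightarrow>\<^sub>0 nat) \<Rightarrow> 'k::field) \<Rightarrow>
    ('x set \<Rightarrow> ('x, 'k) mpoly) \<Rightarrow> 'x set \<Rightarrow> ('x, 'k) mpoly" where
  "khom w z T = (\<Sum>j\<in>T. sgn_ins j (T - {j}) * wlower w j (T - {j}) (z (T - {j})))"

lemma wlower_var_mult:
  assumes "l \<noteq> j" "j \<notin> S"
  shows "wlower w l S (var j * f) = var j * wlower w l (insert j S) f"
proof (rule poly_mapping_eqI)
  fix c
  have 1: "Poly_Mapping.lookup (c + unit_exp l) j = Poly_Mapping.lookup c j"
    using assms(1) by (simp add: lookup_add lookup_unit_exp)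
  show "Poly_Mapping.lookup (wlower w l S (var j * f)) c
      = Poly_Mapping.lookup (var j * wlower w l (insert j S) f) c"
  proof (cases "Poly_Mapping.lookup c j = 0")
    case True
    thus ?thesis by (simp add: wlower_def lookup_lower lookup_var_mult 1)
  next
    case False
    have "c + unit_exp l - unit_exp j = c - unit_exp j + unit_exp l"
      by (rule add_diff_unit[OF False])
    moreover have "c - unit_exp j + unit_exp l + set_exp (insert j S)
        = (c - unit_exp j + unit_exp j) + unit_exp l + set_exp S"
      unfolding set_exp_insert[OF assms(2)] by (simp add: ac_simps)
    ultimately show ?thesis using False
      by (simp add: wlower_def lookup_lower lookup_var_mult 1 diff_unit_add)
  qed
qed

text \<open>
  In a fixed multidegree \<open>a\<close> the Koszul complex is the augmented chain complex of the simplex on the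
  support of \<open>a\<close>, and \<open>khom\<close> is the cone construction, averaged over the vertices \<open>j\<close> with weights
  \<open>w j a\<close>. It commutes with the differential up to sign except where the vertex that is inserted is
  the one that is removed, and these contributions add up to the total weight.
\<close>
lemma koszul_homotopy:
  fixes z :: "'x::finite set \<Rightarrow> ('x, 'k::field) mpoly"
  shows "Poly_Mapping.lookup (kdiff (khom w z) S + khom w (kdiff z) S) c
    = (\<Sum>j | Poly_Mapping.lookup (c + set_exp S) j \<noteq> 0. w j (c + set_exp S))
      * Poly_Mapping.lookup (z S) c"
proof -
  define X where "X j l = sgn_ins j S * sgn_ins l (insert j S - {l}) *
    (var j * wlower w l (insert j S - {l}) (z (insert j S - {l})))" for j l
  have dh: "kdiff (khom w z) S
      = (\<Sum>j\<in>-S. var j * wlower w j S (z S)) + (\<Sum>j\<in>-S. \<Sum>l\<in>S. X j l)"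
    unfolding sum.distrib[symmetric] kdiff_def
  proof (rule sum.cong[OF refl])
    fix j assume "j \<in> - S"
    hence j: "j \<notin> S" "insert j S - {j} = S" by auto
    have "sgn_ins j S * (var j * khom w z (insert j S)) = X j j + (\<Sum>l\<in>S. X j l)"
      using j(1) by (simp add: khom_def X_def sum_distrib_left distrib_left ac_simps
          del: insert_Diff_single)
    also have "X j j = (sgn_ins j S * sgn_ins j S) * (var j * wlower w j S (z S))"
      unfolding X_def j(2) ..
    finally show "sgn_ins j S * (var j * khom w z (insert j S))
        = var j * wlower w j S (z S) + (\<Sum>l\<in>S. X j l)" by (simp add: sgn_ins_square)
  qed
  have hd: "khom w (kdiff z) S
      = (\<Sum>l\<in>S. wlower w l (S - {l}) (var l * z S)) + (\<Sum>l\<in>S. \<Sum>j\<in>-S. - X j l)"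
    unfolding sum.distrib[symmetric] khom_def
  proof (rule sum.cong[OF refl])
    fix l assume l: "l \<in> S"
    define Y where "Y j = sgn_ins l (S - {l}) * sgn_ins j (S - {l}) *
      wlower w l (S - {l}) (var j * z (insert j (S - {l})))" for j
    have compl: "- (S - {l}) = insert l (- S)" "l \<notin> - S" using l by auto
    have "sgn_ins l (S - {l}) * wlower w l (S - {l}) (kdiff z (S - {l}))
        = (\<Sum>j\<in>- (S - {l}). Y j)"
      by (simp add: kdiff_def wlower_def lower_sum lower_sgn_ins sum_distrib_left Y_def mult.assoc
          del: Compl_Diff_eq)
    also have "\<dots> = Y l + (\<Sum>j\<in>-S. Y j)"
      unfolding compl(1) by (rule sum.insert[OF finite compl(2)])
    also have "Y l = wlower w l (S - {l}) (var l * z S)"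
      using l by (simp add: Y_def sgn_ins_square insert_absorb)
    also have "(\<Sum>j\<in>-S. Y j) = (\<Sum>j\<in>-S. - X j l)"
    proof (rule sum.cong[OF refl])
      fix j assume "j \<in> - S"
      hence j: "j \<notin> S" "l \<noteq> j" "j \<notin> S - {l}" "insert j (S - {l}) = insert j S - {l}"
        using l by auto
      show "Y j = - X j l"
        unfolding Y_def X_def wlower_var_mult[OF j(2,3)] j(4)
        using sgn_ins_remove_anticommute[where 'r = "('x, 'k) mpoly", OF j(1) l] by simp
    qed
    finally show "sgn_ins l (S - {l}) * wlower w l (S - {l}) (kdiff z (S - {l}))
      = wlower w l (S - {l}) (var l * z S) + (\<Sum>j\<in>-S. - X j l)" .
  qed
  have "(\<Sum>l\<in>S. \<Sum>j\<in>-S. - X j l) = - (\<Sum>j\<in>-S. \<Sum>l\<in>S. X j l)"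
    by (subst sum.swap) (simp add: sum_negf)
  hence "kdiff (khom w z) S + khom w (kdiff z) S
      = (\<Sum>j\<in>-S. var j * wlower w j S (z S)) + (\<Sum>l\<in>S. wlower w l (S - {l}) (var l * z S))"
    by (simp add: dh hd)
  also have "Poly_Mapping.lookup \<dots> c
      = (\<Sum>j\<in>-S. (if Poly_Mapping.lookup (c + set_exp S) j \<noteq> 0 then w j (c + set_exp S) else 0)
          * Poly_Mapping.lookup (z S) c)
        + (\<Sum>j\<in>S. (if Poly_Mapping.lookup (c + set_exp S) j \<noteq> 0 then w j (c + set_exp S) else 0)
          * Poly_Mapping.lookup (z S) c)"
    unfolding lookup_add lookup_sum
  proof (rule arg_cong2[of _ _ _ _ "(+)"]; rule sum.cong[OF refl])
    fix j assume "j \<in> - S"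
    thus "Poly_Mapping.lookup (var j * wlower w j S (z S)) c
      = (if Poly_Mapping.lookup c j + Poly_Mapping.lookup (set_exp S) j \<noteq> 0
         then w j (c + set_exp S) else 0) * Poly_Mapping.lookup (z S) c"
      by (simp add: lookup_var_mult wlower_def lookup_lower lookup_set_exp diff_unit_add)
  next
    fix j assume j: "j \<in> S"
    have "c + unit_exp j + set_exp (S - {j}) = c + set_exp S"
      by (simp add: add.assoc set_exp_remove[OF j])
    thus "Poly_Mapping.lookup (wlower w j (S - {j}) (var j * z S)) c
      = (if Poly_Mapping.lookup c j + Poly_Mapping.lookup (set_exp S) j \<noteq> 0
         then w j (c + set_exp S) else 0) * Poly_Mapping.lookup (z S) c"
      using j by (simp add: lookup_var_mult wlower_def lookup_lower lookup_set_exp lookup_add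
          lookup_unit_exp)
  qed
  also have "\<dots> = (\<Sum>j\<in>UNIV. (if Poly_Mapping.lookup (c + set_exp S) j \<noteq> 0
      then w j (c + set_exp S) else 0) * Poly_Mapping.lookup (z S) c)"
    by (subst sum.union_disjoint[symmetric]) (auto intro!: sum.cong)
  also have "\<dots> = (\<Sum>j | Poly_Mapping.lookup (c + set_exp S) j \<noteq> 0. w j (c + set_exp S))
      * Poly_Mapping.lookup (z S) c"
    unfolding sum_distrib_right[symmetric] by (simp add: sum.If_cases)
  finally show ?thesis .
qed

text \<open>
  The submodule \<open>M F\<close> of a free module \<open>F\<close> with basis \<open>J\<close>, or \<open>F \<otimes> M\<close>, padded by zeros to functions on
  the whole type.
\<close>
definition tuples :: "'a set \<Rightarrow> 'm::zero set \<Rightarrow> ('a \<Rightarrow> 'm) set" where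
  "tuples J M = {z. (\<forall>j\<in>J. z j \<in> M) \<and> (\<forall>j. j \<notin> J \<longrightarrow> z j = 0)}"

lemma tuplesI: "(\<And>j. j \<in> J \<Longrightarrow> z j \<in> M) \<Longrightarrow> (\<And>j. j \<notin> J \<Longrightarrow> z j = 0) \<Longrightarrow> z \<in> tuples J M"
  by (simp add: tuples_def)

lemma tuples_outside: "z \<in> tuples J M \<Longrightarrow> j \<notin> J \<Longrightarrow> z j = 0"
  by (simp add: tuples_def)

lemma tuples_in: "z \<in> tuples J M \<Longrightarrow> is_ideal M \<Longrightarrow> z j \<in> M"
  by (cases "j \<in> J") (auto simp: tuples_def ideal_zero)

lemma tuples_mono: "M \<subseteq> N \<Longrightarrow> tuples J M \<subseteq> tuples J N"
  by (auto simp: tuples_def)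

lemma tuples_diff:
  "is_ideal M \<Longrightarrow> y \<in> tuples J M \<Longrightarrow> z \<in> tuples J M \<Longrightarrow> y - z \<in> tuples J M"
  by (auto simp: tuples_def ideal_diff)

text \<open>The index set of the basis of the Koszul complex in homological degree \<open>i\<close>.\<close>
definition faces :: "nat \<Rightarrow> 'x::finite set set" where
  "faces i = {S. card S = i}"

lemma kdiff_tuples:
  assumes "is_ideal M" "z \<in> tuples (faces (Suc i)) M"
  shows "kdiff z \<in> tuples (faces i) M"
proof (rule tuplesI)
  show "kdiff z S \<in> M" for S
    unfolding kdiff_def by (intro ideal_sum ideal_mult assms(1) tuples_in[OF assms(2,1)])
  show "kdiff z S = 0" if "S \<notin> faces i" for S
    unfolding kdiff_def
    by (rule sum.neutral) (use that assms(2) in \<open>auto simp: tuples_def faces_def\<close>)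
qed

lemma kdiff_faces_0: "z \<in> tuples (faces 0) M \<Longrightarrow> kdiff z = 0"
  by (rule ext, simp add: kdiff_def, rule sum.neutral) (auto simp: tuples_def faces_def)

text \<open>
  At multidegrees \<open>a \<noteq> 0\<close> the total weight is \<open>1\<close>, so that the homotopy itself gives \<open>y\<close>. At multidegree
  \<open>0\<close> the complex is not contractible; there only the constant coefficient in homological degree \<open>0\<close>
  occurs.
\<close>

lemma kdiff_boundary:
  fixes z :: "'x::finite set \<Rightarrow> ('x, 'k::field) mpoly"
  assumes z: "z \<in> tuples (faces i) M" and cycle: "kdiff z = 0"
    and const: "Poly_Mapping.lookup (z {}) 0 = 0"
    and w: "\<And>a. a \<noteq> 0 \<Longrightarrow> (\<Sum>j | Poly_Mapping.lookup a j \<noteq> 0. w j a) = 1"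
    and M: "is_ideal M" and N: "is_ideal N"
    and MN: "\<And>j S f. j \<notin> S \<Longrightarrow> f \<in> M \<Longrightarrow> wlower w j S f \<in> N"
  shows "\<exists>y\<in>tuples (faces (Suc i)) N. kdiff y = z"
proof
  show "khom w z \<in> tuples (faces (Suc i)) N"
  proof (rule tuplesI)
    show "khom w z T \<in> N" for T
      unfolding khom_def by (intro ideal_sum[OF N] ideal_mult[OF N] MN tuples_in[OF z M]) auto
    show "khom w z T = 0" if "T \<notin> faces (Suc i)" for T
      unfolding khom_def
    proof (rule sum.neutral, rule ballI)
      fix j assume "j \<in> T"
      hence "T - {j} \<notin> faces i" using that card_Suc_Diff1[OF finite, of j T] by (auto simp: faces_def)
      thus "sgn_ins j (T - {j}) * wlower w j (T - {j}) (z (T - {j})) = 0"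
        using z by (simp add: tuples_outside wlower_def lower_zero)
    qed
  qed
  show "kdiff (khom w z) = z"
  proof (rule ext, rule poly_mapping_eqI)
    fix S and c :: "'x \<Rightarrow>\<^sub>0 nat"
    have "khom w (kdiff z) S = 0"
      by (simp add: cycle khom_def wlower_def lower_zero)
    hence *: "Poly_Mapping.lookup (kdiff (khom w z) S) c
        = (\<Sum>j | Poly_Mapping.lookup (c + set_exp S) j \<noteq> 0. w j (c + set_exp S))
          * Poly_Mapping.lookup (z S) c"
      using koszul_homotopy[of w z S c] by simp
    show "Poly_Mapping.lookup (kdiff (khom w z) S) c = Poly_Mapping.lookup (z S) c"
    proof (cases "c + set_exp S = 0")
      case True
      have "Poly_Mapping.lookup (c + set_exp S) l = 0" for l by (simp add: True)
      hence "Poly_Mapping.lookup c l = 0 \<and> l \<notin> S" for l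
        by (metis add_is_0 lookup_add lookup_set_exp zero_neq_one)
      hence "c = 0" "S = {}" by (auto intro: poly_mapping_eqI)
      thus ?thesis using * const by simp
    next
      case False
      show ?thesis unfolding * w[OF False] by simp
    qed
  qed
qed

text \<open>
  Two choices of weights with sum \<open>1\<close>. The first turns the homotopy into the de Rham differential
  divided by the total degree, and needs characteristic \<open>0\<close>. The second uses a single variable in
  each multidegree; it works in every characteristic, but treats the terms of a
  polynomial differently, so that it is compatible with monomial ideals only.
\<close>
definition degree_weight :: "'x \<Rightarrow> ('x::finite \<Rightarrow>\<^sub>0 nat) \<Rightarrow> 'k::field" where
  "degree_weight j a = of_nat (Poly_Mapping.lookup a j) / of_nat (mdeg a)"

definition choice_weight :: "'x \<Rightarrow> ('x::finite \<Rightarrow>\<^sub>0 nat) \<Rightarrow> 'k::field" where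
  "choice_weight j a = (if j = (SOME l. Poly_Mapping.lookup a l \<noteq> 0) then 1 else 0)"

lemma sum_degree_weight:
  assumes "CHAR('k::field) = 0" "a \<noteq> 0"
  shows "(\<Sum>j | Poly_Mapping.lookup a j \<noteq> 0. degree_weight j a) = (1 :: 'k)"
proof -
  have "mdeg a \<noteq> 0" using assms(2) by (auto simp: mdeg_def intro: poly_mapping_eqI)
  hence nz: "of_nat (mdeg a) \<noteq> (0 :: 'k)" using assms(1) by (simp add: of_nat_eq_0_iff_char_dvd)
  have "(\<Sum>j | Poly_Mapping.lookup a j \<noteq> 0. degree_weight j a)
      = (\<Sum>j\<in>UNIV. of_nat (Poly_Mapping.lookup a j) / of_nat (mdeg a) :: 'k)"
    unfolding degree_weight_def by (rule sum.mono_neutral_left) auto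
  also have "\<dots> = 1" using nz by (simp add: mdeg_def flip: sum_divide_distrib of_nat_sum)
  finally show ?thesis .
qed

lemma sum_choice_weight:
  assumes "a \<noteq> 0"
  shows "(\<Sum>j | Poly_Mapping.lookup a j \<noteq> 0. choice_weight j a) = (1 :: 'k::field)"
proof -
  have "\<exists>l. Poly_Mapping.lookup a l \<noteq> 0" using assms by (metis lookup_zero poly_mapping_eqI)
  hence "Poly_Mapping.lookup a (SOME l. Poly_Mapping.lookup a l \<noteq> 0) \<noteq> 0" by (rule someI_ex)
  thus ?thesis by (simp add: choice_weight_def)
qed

lemma koszul_exact:
  assumes "z \<in> tuples (faces i) UNIV" "kdiff z = 0" "Poly_Mapping.lookup (z {}) 0 = 0"
  shows "\<exists>y\<in>tuples (faces (Suc i)) UNIV. kdiff y = z"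
  by (rule kdiff_boundary[OF assms sum_choice_weight]) (simp_all add: is_ideal_UNIV)

lemma lookup_const_mult: "Poly_Mapping.lookup (Poly_Mapping.single 0 c * f) b = c * Poly_Mapping.lookup f b"
  by (simp add: map.rep_eq when_def flip: mult_map_scale_conv_mult)

text \<open>
  If \<open>f\<close> is homogeneous of degree \<open>d\<close>, all monomials of \<open>f e\<^sub>S\<close> have the same total degree
  \<open>d + card S\<close>. As \<open>j \<notin> S\<close>, the exponent of \<open>x\<^sub>j\<close> in the multidegree is the one that differentiation
  of \<open>f\<close> produces.
\<close>
lemma wlower_degree_weight:
  fixes f :: "('x::finite, 'k::field) mpoly"
  assumes "j \<notin> S" "f \<in> homogeneous_elements"
  shows "\<exists>\<alpha>. wlower degree_weight j S f = \<alpha> * partial j f"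
proof -
  obtain d where d: "\<And>b. Poly_Mapping.lookup f b \<noteq> 0 \<Longrightarrow> mdeg b = d"
    using assms(2) by (auto simp: homogeneous_elements_def in_keys_iff)
  have "wlower degree_weight j S f = Poly_Mapping.single 0 (1 / of_nat (d + card S)) * partial j f"
  proof (rule poly_mapping_eqI)
    fix c
    show "Poly_Mapping.lookup (wlower degree_weight j S f) c
      = Poly_Mapping.lookup (Poly_Mapping.single 0 (1 / of_nat (d + card S)) * partial j f) c"
    proof (cases "Poly_Mapping.lookup f (c + unit_exp j) = 0")
      case False
      hence "mdeg (c + unit_exp j + set_exp S) = d + card S"
        using d by (simp add: mdeg_add[of _ "set_exp S"] mdeg_set_exp)
      moreover have "Poly_Mapping.lookup (c + unit_exp j + set_exp S) j = Poly_Mapping.lookup c j + 1"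
        using assms(1) by (simp add: lookup_add lookup_unit_exp lookup_set_exp)
      ultimately show ?thesis
        by (simp add: wlower_def lookup_lower lookup_const_mult lookup_partial degree_weight_def)
    qed (simp add: wlower_def lookup_lower lookup_const_mult lookup_partial)
  qed
  thus ?thesis ..
qed

lemma wlower_terms:
  assumes "f \<in> terms"
  shows "\<exists>\<alpha>. wlower w j S f = \<alpha> * strip j f"
proof -
  obtain b v where f: "f = Poly_Mapping.single b v" using assms by (auto simp: terms_def)
  have "wlower w j S f
    = Poly_Mapping.single 0 (w j (b - unit_exp j + unit_exp j + set_exp S)) * strip j f"
    by (simp add: f wlower_def lower_single mult_single)
  thus ?thesis ..
qed

lemma max_ideal_const: "f \<in> max_ideal \<Longrightarrow> Poly_Mapping.lookup f 0 = 0"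
  unfolding max_ideal_def ideal_span_def
proof (induction rule: module.span_induct_alt[OF module_mult, consumes 1, case_names base step])
  case (step c x y)
  then obtain j where "x = var j" by (auto simp: unit_exp_def)
  thus ?case using step(2) lookup_var_mult[of j c 0] by (simp add: lookup_add mult.commute)
qed simp

lemma var_in_max_ideal: "var j \<in> max_ideal"
  unfolding max_ideal_def by (rule ideal_span_base) (auto simp: unit_exp_def)

lemma is_ideal_max_ideal: "is_ideal max_ideal"
  unfolding max_ideal_def by (rule is_ideal_ideal_span)

section \<open>Inclusions of ideals that vanish on Koszul homology\<close>

definition koszul_vanishing ::
    "('x::finite, 'k::field) mpoly set \<Rightarrow> ('x, 'k) mpoly set \<Rightarrow> bool" where
  "koszul_vanishing M N \<longleftrightarrow>
     (\<forall>i. \<forall>z\<in>tuples (faces i) M. kdiff z = 0 \<longrightarrow> (\<exists>y\<in>tuples (faces (Suc i)) N. kdiff y = z))"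

lemma koszul_vanishing_mono:
  "koszul_vanishing M N \<Longrightarrow> M' \<subseteq> M \<Longrightarrow> N \<subseteq> N' \<Longrightarrow> koszul_vanishing M' N'"
  unfolding koszul_vanishing_def by (meson subsetD tuples_mono)

text \<open>
  The homotopy maps \<open>M\<close> to \<open>N\<close> because, on elements of \<open>G\<close>, each of its components is a multiple of
  \<open>\<delta> j\<close>, and elements of \<open>G\<close> generate \<open>M\<close> additively.
\<close>
lemma koszul_vanishing_lowering:
  assumes w: "\<And>a. a \<noteq> 0 \<Longrightarrow> (\<Sum>j | Poly_Mapping.lookup a j \<noteq> 0. w j a) = 1"
    and \<delta>: "\<And>j. leibniz_operator G (\<delta> j)"
    and w\<delta>: "\<And>j S f. j \<notin> S \<Longrightarrow> f \<in> G \<Longrightarrow> \<exists>\<alpha>. wlower w j S f = \<alpha> * \<delta> j f"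
    and M: "sum_generated G M" "M \<subseteq> max_ideal" and N: "is_ideal N"
    and MN: "\<And>j. \<delta> j ` M \<subseteq> N"
  shows "koszul_vanishing M N"
  unfolding koszul_vanishing_def
proof (intro allI ballI impI)
  fix i and z :: "'a set \<Rightarrow> ('a, 'b) mpoly"
  assume z: "z \<in> tuples (faces i) M" "kdiff z = 0"
  have isM: "is_ideal M" using M(1) by (simp add: sum_generated_def)
  have "Poly_Mapping.lookup (z {}) 0 = 0"
    using tuples_in[OF z(1) isM] M(2) by (auto intro: max_ideal_const)
  moreover have "wlower w j S f \<in> N" if jS: "j \<notin> S" and f: "f \<in> M" for j S f
  proof -
    have "f \<in> finite_sums (M \<inter> G)" using M(1) f by (auto simp: sum_generated_def)
    thus ?thesis
    proof induction
      case zero show ?case using N by (simp add: wlower_def lower_zero ideal_zero)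
    next
      case (add a b)
      obtain \<alpha> where "wlower w j S a = \<alpha> * \<delta> j a" using w\<delta>[OF jS, of a] add(1) by auto
      hence "wlower w j S a \<in> N" using MN[of j] add(1) N by (auto intro!: ideal_mult)
      thus ?case using add(3) N by (simp add: wlower_def lower_add ideal_add)
    qed
  qed
  ultimately show "\<exists>y\<in>tuples (faces (Suc i)) N. kdiff y = z"
    by (intro kdiff_boundary[OF z _ w isM N])
qed

lemma pow_prod_subset_max_ideal:
  assumes "is_ideal I" "I \<subseteq> ideal_pow max_ideal 2"
  shows "ideal_prod (ideal_pow max_ideal p) (ideal_pow I (Suc n)) \<subseteq> max_ideal"
proof -
  have "ideal_prod (ideal_pow max_ideal p) (ideal_pow I (Suc n)) \<subseteq> ideal_pow I (Suc n)"
    by (rule ideal_prod_subset_right[OF is_ideal_ideal_pow])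
  also have "\<dots> \<subseteq> ideal_pow I (Suc 0)" by (rule ideal_pow_antimono) simp
  also have "\<dots> \<subseteq> ideal_pow max_ideal 2" using assms(2) by (simp only: ideal_pow_one[OF assms(1)])
  also have "\<dots> \<subseteq> ideal_pow max_ideal (Suc 0)" by (rule ideal_pow_antimono) simp
  also have "\<dots> = max_ideal" by (rule ideal_pow_one[OF is_ideal_max_ideal])
  finally show ?thesis .
qed

lemma koszul_vanishing_char_0:
  fixes I :: "('x::finite, 'k::field) mpoly set"
  assumes "CHAR('k) = 0" "homogeneous_ideal I" "I \<subseteq> ideal_pow max_ideal 2"
  shows "koszul_vanishing (ideal_prod (ideal_pow max_ideal p) (ideal_pow I (Suc n)))
    (ideal_prod (ideal_pow max_ideal (Suc p)) (ideal_pow I n))"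
proof -
  note L = leibniz_operator_partial
  obtain S where S: "S \<subseteq> (\<Union>d. hom_part d)" "I = ideal_span S"
    using assms(2) by (auto simp: homogeneous_ideal_def)
  have "f \<in> homogeneous_elements" if "f \<in> hom_part d" for f :: "('x, 'k) mpoly" and d
    unfolding homogeneous_elements_def
    by (rule CollectI, rule exI[of _ "nat d"]) (use that in \<open>auto simp: hom_part_def\<close>)
  hence "S \<subseteq> homogeneous_elements" using S(1) by blast
  hence gI: "sum_generated homogeneous_elements I"
    unfolding S(2) by (rule leibniz_operator.sum_generated_ideal_span[OF L])
  have gm: "sum_generated homogeneous_elements (max_ideal :: ('x, 'k) mpoly set)"
    by (rule sum_generated_max_ideal[OF terms_subset_homogeneous_elements L])
  show ?thesis
  proof (rule koszul_vanishing_lowering[OF sum_degree_weight[OF assms(1)] L wlower_degree_weight])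
    show "sum_generated homogeneous_elements (ideal_prod (ideal_pow max_ideal p) (ideal_pow I (Suc n)))"
      by (intro leibniz_operator.sum_generated_ideal_prod(1)[OF L]
          leibniz_operator.sum_generated_ideal_pow[OF L] gm gI)
    show "partial j ` ideal_prod (ideal_pow max_ideal p) (ideal_pow I (Suc n))
      \<subseteq> ideal_prod (ideal_pow max_ideal (Suc p)) (ideal_pow I n)" for j
      by (rule leibniz_operator.delta_ideal_pow_prod[OF L gm gI assms(3)])
  qed (simp_all add: is_ideal_ideal_prod pow_prod_subset_max_ideal S(2) is_ideal_ideal_span
      assms(3)[unfolded S(2)] del: ideal_pow.simps)
qed

lemma koszul_vanishing_monomial:
  fixes I :: "('x::finite, 'k::field) mpoly set"
  assumes "monomial_ideal I" "I \<subseteq> ideal_pow max_ideal 2"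
  shows "koszul_vanishing (ideal_prod (ideal_pow max_ideal p) (ideal_pow I (Suc n)))
    (ideal_prod (ideal_pow max_ideal (Suc p)) (ideal_pow I n))"
proof -
  note L = leibniz_operator_strip
  obtain A where A: "I = ideal_span ((\<lambda>a. Poly_Mapping.single a 1) ` A)"
    using assms(1) by (auto simp: monomial_ideal_def)
  have gI: "sum_generated terms I"
    unfolding A by (rule leibniz_operator.sum_generated_ideal_span[OF L]) (auto simp: terms_def)
  have gm: "sum_generated terms (max_ideal :: ('x, 'k) mpoly set)"
    by (rule sum_generated_max_ideal[OF order_refl L])
  show ?thesis
  proof (rule koszul_vanishing_lowering[OF sum_choice_weight L wlower_terms])
    show "sum_generated terms (ideal_prod (ideal_pow max_ideal p) (ideal_pow I (Suc n)))"
      by (intro leibniz_operator.sum_generated_ideal_prod(1)[OF L]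
          leibniz_operator.sum_generated_ideal_pow[OF L] gm gI)
    show "strip j ` ideal_prod (ideal_pow max_ideal p) (ideal_pow I (Suc n))
      \<subseteq> ideal_prod (ideal_pow max_ideal (Suc p)) (ideal_pow I n)" for j
      by (rule leibniz_operator.delta_ideal_pow_prod[OF L gm gI assms(2)])
  qed (use assms(2) A in \<open>simp_all add: is_ideal_ideal_prod pow_prod_subset_max_ideal
      is_ideal_ideal_span del: ideal_pow.simps\<close>)
qed

text \<open>The weights by choice of a variable make this hold in every characteristic.\<close>
lemma koszul_vanishing_max_ideal_pow:
  "koszul_vanishing (ideal_pow max_ideal (Suc q)) (ideal_pow (max_ideal :: ('x::finite, 'k::field) mpoly set) q)"
proof -
  note L = leibniz_operator_strip
  have gm: "sum_generated terms (max_ideal :: ('x, 'k) mpoly set)"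
    by (rule sum_generated_max_ideal[OF order_refl L])
  show ?thesis
  proof (rule koszul_vanishing_lowering[OF sum_choice_weight L wlower_terms])
    show "sum_generated terms (ideal_pow max_ideal (Suc q) :: ('x, 'k) mpoly set)"
      by (rule leibniz_operator.sum_generated_ideal_pow[OF L gm])
    show "strip j ` ideal_pow max_ideal (Suc q) \<subseteq> ideal_pow (max_ideal :: ('x, 'k) mpoly set) q" for j
      using leibniz_operator.delta_ideal_pow[OF L gm, of j "Suc q"] by simp
    show "ideal_pow max_ideal (Suc q) \<subseteq> (max_ideal :: ('x, 'k) mpoly set)"
      using ideal_pow_antimono[of "Suc 0" "Suc q" "max_ideal :: ('x, 'k) mpoly set"]
      by (simp add: ideal_pow_one[OF is_ideal_max_ideal] del: ideal_pow.simps)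
  qed (simp_all add: is_ideal_ideal_pow)
qed

section \<open>Comparison of free resolutions\<close>

definition smul :: "'r::comm_ring_1 \<Rightarrow> ('a \<Rightarrow> 'r) \<Rightarrow> 'a \<Rightarrow> 'r" where
  "smul r z = (\<lambda>i. r * z i)"

lemma module_smul: "module smul"
  by unfold_locales (simp_all add: smul_def fun_eq_iff algebra_simps)

lemma module_pair_smul: "module_pair smul smul"
  by (simp add: module_pair_def module_smul)

abbreviation rhom :: "(('a \<Rightarrow> 'r::comm_ring_1) \<Rightarrow> ('b \<Rightarrow> 'r)) \<Rightarrow> bool" where
  "rhom \<equiv> module_hom smul smul"

lemma module_homI:
  assumes "module s" "module t" "\<And>x y. f (x + y) = f x + f y" "\<And>r x. f (s r x) = t r (f x)"
  shows "module_hom s t f"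
  using assms by (simp add: module_hom_iff)

definition basis :: "'a \<Rightarrow> 'a \<Rightarrow> 'r::comm_ring_1" where
  "basis j = (\<lambda>i. if i = j then 1 else 0)"

lemma basis_tuples: "j \<in> J \<Longrightarrow> basis j \<in> tuples J UNIV"
  by (auto simp: tuples_def basis_def)

lemma sum_fun_apply: "(\<Sum>j\<in>J. f j) i = (\<Sum>j\<in>J. f j i)"
  by (induction J rule: infinite_finite_induct) simp_all

lemma tuples_expand:
  assumes "finite J" "z \<in> tuples J M"
  shows "z = (\<Sum>j\<in>J. smul (z j) (basis j))"
proof
  fix i
  show "z i = (\<Sum>j\<in>J. smul (z j) (basis j)) i"
    using assms by (cases "i \<in> J") (simp_all add: sum_fun_apply smul_def basis_def tuples_def if_distrib cong: if_cong)
qed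

lemma hom_tuples_expand:
  assumes "module_hom smul sc f" "finite J" "z \<in> tuples J M"
  shows "f z = (\<Sum>j\<in>J. sc (z j) (f (basis j)))"
proof -
  have "f z = f (\<Sum>j\<in>J. smul (z j) (basis j))" using tuples_expand[OF assms(2,3)] by simp
  also have "\<dots> = (\<Sum>j\<in>J. sc (z j) (f (basis j)))"
    by (simp add: module_hom.sum[OF assms(1)] module_hom.scale[OF assms(1)])
  finally show ?thesis .
qed

text \<open>
  A linear map between free modules \<open>F\<close> and \<open>F'\<close> is a matrix over the ring and therefore maps \<open>M F\<close>
  to \<open>M F'\<close>, for every ideal \<open>M\<close>. Thus comparison maps between resolutions act on their tensor
  products with ideals.
\<close>
lemma hom_tuples:
  assumes "rhom f" "f ` tuples J UNIV \<subseteq> tuples J' UNIV" "finite J" "is_ideal M" "z \<in> tuples J M"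
  shows "f z \<in> tuples J' M"
proof (rule tuplesI)
  show "f z i \<in> M" for i
    unfolding hom_tuples_expand[OF assms(1,3,5)] sum_fun_apply smul_def
    by (intro ideal_sum[OF assms(4)] ideal_mult_right[OF assms(4)] tuples_in[OF assms(5,4)])
  have "f z \<in> tuples J' UNIV" using assms(2,5) tuples_mono[of M UNIV J] by blast
  thus "f z i = 0" if "i \<notin> J'" for i using that by (rule tuples_outside)
qed

lemma sum_tuples: "(\<And>j. j \<in> J \<Longrightarrow> f j \<in> tuples J' UNIV) \<Longrightarrow> sum f J \<in> tuples J' UNIV"
  by (auto simp: tuples_def sum_fun_apply intro!: sum.neutral)

lemma hom_lift:
  assumes J: "finite J" and \<phi>: "module_hom smul sc \<phi>" and d: "module_hom smul sc d"
    and ex: "\<phi> ` tuples J UNIV \<subseteq> d ` tuples J' UNIV"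
  obtains \<psi> where "rhom \<psi>" "\<psi> ` tuples J UNIV \<subseteq> tuples J' UNIV"
    "\<And>z. z \<in> tuples J UNIV \<Longrightarrow> d (\<psi> z) = \<phi> z"
proof -
  have "\<forall>j\<in>J. \<exists>y. y \<in> tuples J' UNIV \<and> d y = \<phi> (basis j)"
  proof
    fix j assume "j \<in> J"
    hence "\<phi> (basis j) \<in> \<phi> ` tuples J UNIV" by (intro imageI basis_tuples)
    hence "\<phi> (basis j) \<in> d ` tuples J' UNIV" using ex by (rule rev_subsetD)
    thus "\<exists>y. y \<in> tuples J' UNIV \<and> d y = \<phi> (basis j)" by auto
  qed
  from bchoice[OF this] obtain y
    where y: "\<And>j. j \<in> J \<Longrightarrow> y j \<in> tuples J' UNIV" "\<And>j. j \<in> J \<Longrightarrow> d (y j) = \<phi> (basis j)" by blast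
  define \<psi> where "\<psi> z = (\<Sum>j\<in>J. smul (z j) (y j))" for z
  show ?thesis
  proof (rule that)
    show "rhom \<psi>"
      by (rule module_homI[OF module_smul module_smul])
         (simp_all add: \<psi>_def fun_eq_iff sum_fun_apply smul_def distrib_right sum.distrib
           sum_distrib_left mult.assoc)
    have "\<psi> z \<in> tuples J' UNIV" for z
      unfolding \<psi>_def
    proof (rule sum_tuples)
      show "smul (z j) (y j) \<in> tuples J' UNIV" if "j \<in> J" for j
        using y(1)[OF that] by (simp add: tuples_def smul_def)
    qed
    thus "\<psi> ` tuples J UNIV \<subseteq> tuples J' UNIV" by (rule image_subsetI)
    show "d (\<psi> z) = \<phi> z" if "z \<in> tuples J UNIV" for z
      unfolding hom_tuples_expand[OF \<phi> J that] \<psi>_def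
      by (simp add: module_hom.sum[OF d] module_hom.scale[OF d] y(2))
  qed
qed

text \<open>
  The map \<open>d i\<close> goes from degree \<open>i + 1\<close> to degree \<open>i\<close>. Unlike in \<^const>\<open>free_resolution\<close> the bases
  may be indexed by any type, so that the Koszul complex fits in.
\<close>

locale based_resolution =
  fixes J :: "nat \<Rightarrow> 'a set" and d :: "nat \<Rightarrow> ('a \<Rightarrow> 'r::comm_ring_1) \<Rightarrow> 'a \<Rightarrow> 'r"
    and aug :: "('a \<Rightarrow> 'r) \<Rightarrow> 'm::ab_group_add" and sc :: "'r \<Rightarrow> 'm \<Rightarrow> 'm" and U :: "'m set"
  assumes fin: "finite (J i)"
    and d_hom: "rhom (d i)"
    and aug_hom: "module_hom smul sc aug"
    and aug_surj: "aug ` tuples (J 0) UNIV = U"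
    and exact_0: "{z \<in> tuples (J 0) UNIV. aug z = 0} = d 0 ` tuples (J (Suc 0)) UNIV"
    and exact_Suc: "{z \<in> tuples (J (Suc i)) UNIV. d i z = 0} = d (Suc i) ` tuples (J (Suc (Suc i))) UNIV"
begin

text \<open>
  In degree \<open>0\<close> these are the cycles of the augmented complex, so that cycles and boundaries agree in
  all degrees.
\<close>
definition cyc :: "nat \<Rightarrow> ('a \<Rightarrow> 'r) set" where
  "cyc i = {z \<in> tuples (J i) UNIV. case i of 0 \<Rightarrow> aug z = 0 | Suc k \<Rightarrow> d k z = 0}"

lemma cyc_0: "cyc 0 = {z \<in> tuples (J 0) UNIV. aug z = 0}"
  by (simp add: cyc_def)

lemma cyc_Suc: "cyc (Suc i) = {z \<in> tuples (J (Suc i)) UNIV. d i z = 0}"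
  by (simp add: cyc_def)

lemma cyc_eq: "cyc i = d i ` tuples (J (Suc i)) UNIV"
  by (cases i) (simp_all only: cyc_0 cyc_Suc exact_0 exact_Suc)

lemma d_maps: "d i ` tuples (J (Suc i)) UNIV \<subseteq> tuples (J i) UNIV"
  unfolding cyc_eq[symmetric] by (simp add: cyc_def subset_iff)

lemma d_in: "z \<in> tuples (J (Suc i)) UNIV \<Longrightarrow> d i z \<in> tuples (J i) UNIV"
  using d_maps[of i] by (rule subsetD) (rule imageI)

lemma d_d:
  assumes "z \<in> tuples (J (Suc (Suc i))) UNIV"
  shows "d i (d (Suc i) z) = 0"
proof -
  have "d (Suc i) z \<in> cyc (Suc i)" unfolding cyc_eq using assms by (rule imageI)
  thus ?thesis by (simp add: cyc_Suc)
qed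

end

text \<open>
  The recursion for \<open>f\<close> carries along that \<open>f i\<close> maps cycles to cycles, which is what makes the
  lifting problem for \<open>f (i + 1)\<close> solvable.
\<close>
lemma comparison_map:
  assumes A: "based_resolution J d aug sc U" and B: "based_resolution J' d' aug' sc U"
  obtains f where "\<And>i. rhom (f i)" "\<And>i. f i ` tuples (J i) UNIV \<subseteq> tuples (J' i) UNIV"
    "\<And>z. z \<in> tuples (J 0) UNIV \<Longrightarrow> aug' (f 0 z) = aug z"
    "\<And>i z. z \<in> tuples (J (Suc i)) UNIV \<Longrightarrow> d' i (f (Suc i) z) = f i (d i z)"
proof -
  interpret A: based_resolution J d aug sc U by (rule A)
  interpret B: based_resolution J' d' aug' sc U by (rule B)
  define P where "P i f \<longleftrightarrow> rhom f \<and> f ` tuples (J i) UNIV \<subseteq> tuples (J' i) UNIV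
    \<and> (i = 0 \<longrightarrow> (\<forall>z\<in>tuples (J i) UNIV. aug' (f z) = aug z)) \<and> f ` A.cyc i \<subseteq> B.cyc i" for i f
  define Q where "Q i f g \<longleftrightarrow> (\<forall>z\<in>tuples (J (Suc i)) UNIV. d' i (g z) = f (d i z))" for i f g
  have "\<exists>f. \<forall>i. P i (f i) \<and> Q i (f i) (f (Suc i))"
  proof (rule dependent_nat_choice)
    have "aug ` tuples (J 0) UNIV \<subseteq> aug' ` tuples (J' 0) UNIV" by (simp add: A.aug_surj B.aug_surj)
    then obtain f where f: "rhom f" "f ` tuples (J 0) UNIV \<subseteq> tuples (J' 0) UNIV"
        "\<And>z. z \<in> tuples (J 0) UNIV \<Longrightarrow> aug' (f z) = aug z"
      by (rule hom_lift[OF A.fin A.aug_hom B.aug_hom]) blast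
    have "f ` A.cyc 0 \<subseteq> B.cyc 0" using f(2,3) by (auto simp: A.cyc_0 B.cyc_0)
    thus "\<exists>f. P 0 f" using f by (intro exI[of _ f]) (simp add: P_def)
  next
    fix f i assume P: "P i f"
    note f = P[unfolded P_def, THEN conjunct1]
    have fd: "module_hom smul smul (f \<circ> d i)" by (rule module_hom_compose[OF A.d_hom f])
    have fc: "f ` A.cyc i \<subseteq> B.cyc i" using P by (simp add: P_def)
    hence "(f \<circ> d i) ` tuples (J (Suc i)) UNIV \<subseteq> d' i ` tuples (J' (Suc i)) UNIV"
      by (simp add: A.cyc_eq B.cyc_eq image_comp)
    then obtain g where g: "rhom g" "g ` tuples (J (Suc i)) UNIV \<subseteq> tuples (J' (Suc i)) UNIV"
        "\<And>z. z \<in> tuples (J (Suc i)) UNIV \<Longrightarrow> d' i (g z) = (f \<circ> d i) z"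
      by (rule hom_lift[OF A.fin fd B.d_hom]) blast
    have "g ` A.cyc (Suc i) \<subseteq> B.cyc (Suc i)"
      using g(2,3) by (auto simp: A.cyc_Suc B.cyc_Suc module_hom.zero[OF f])
    hence "P (Suc i) g" using g(1,2) by (simp add: P_def)
    moreover have "Q i f g" using g(3) by (simp add: Q_def)
    ultimately show "\<exists>g. P (Suc i) g \<and> Q i f g" by blast
  qed
  then obtain f where f: "\<And>i. P i (f i) \<and> Q i (f i) (f (Suc i))" by blast
  show ?thesis
  proof (rule that)
    show "rhom (f i)" "f i ` tuples (J i) UNIV \<subseteq> tuples (J' i) UNIV" for i
      using f[of i] by (simp_all add: P_def)
    show "aug' (f 0 z) = aug z" if "z \<in> tuples (J 0) UNIV" for z
      using f[of 0] that by (simp add: P_def)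
    show "d' i (f (Suc i) z) = f i (d i z)" if "z \<in> tuples (J (Suc i)) UNIV" for i z
      using f[of i] that by (simp add: Q_def)
  qed
qed

text \<open>
  As \<open>\<phi>\<close> induces \<open>0\<close> on the resolved module, it is null-homotopic. The homotopy \<open>s\<close>
  satisfies \<open>d s + s d = \<phi>\<close>, which on cycles reduces to \<open>d s = \<phi>\<close>.
\<close>
lemma comparison_homotopy:
  fixes J :: "nat \<Rightarrow> 'a set" and d :: "nat \<Rightarrow> ('a \<Rightarrow> 'r::comm_ring_1) \<Rightarrow> 'a \<Rightarrow> 'r"
  assumes A: "based_resolution J d aug sc U"
    and \<phi>: "\<And>i. rhom (\<phi> i)" "\<And>i. \<phi> i ` tuples (J i) UNIV \<subseteq> tuples (J i) UNIV"
    and aug: "\<And>z. z \<in> tuples (J 0) UNIV \<Longrightarrow> aug (\<phi> 0 z) = 0"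
    and chain: "\<And>i z. z \<in> tuples (J (Suc i)) UNIV \<Longrightarrow> d i (\<phi> (Suc i) z) = \<phi> i (d i z)"
  obtains s where "\<And>i. rhom (s i)" "\<And>i. s i ` tuples (J i) UNIV \<subseteq> tuples (J (Suc i)) UNIV"
    "\<And>i z. z \<in> tuples (J i) UNIV \<Longrightarrow> \<forall>k. i = Suc k \<longrightarrow> d k z = 0 \<Longrightarrow> d i (s i z) = \<phi> i z"
proof -
  interpret A: based_resolution J d aug sc U by (rule A)
  define P where "P i s \<longleftrightarrow> rhom s \<and> s ` tuples (J i) UNIV \<subseteq> tuples (J (Suc i)) UNIV
    \<and> (i = 0 \<longrightarrow> (\<forall>z\<in>tuples (J i) UNIV. d i (s z) = \<phi> i z))
    \<and> (\<forall>z\<in>tuples (J (Suc i)) UNIV. \<phi> (Suc i) z - s (d i z) \<in> A.cyc (Suc i))" for i s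
  define Q where "Q i s t \<longleftrightarrow>
    (\<forall>z\<in>tuples (J (Suc i)) UNIV. d (Suc i) (t z) = \<phi> (Suc i) z - s (d i z))" for i s t
  have diff: "y - z \<in> tuples (J i) UNIV" if "y \<in> tuples (J i) UNIV" "z \<in> tuples (J i) UNIV"
    for i and y z :: "'a \<Rightarrow> 'r"
    by (rule tuples_diff[OF is_ideal_UNIV that])
  have "\<exists>s. \<forall>i. P i (s i) \<and> Q i (s i) (s (Suc i))"
  proof (rule dependent_nat_choice)
    have "\<phi> 0 ` tuples (J 0) UNIV \<subseteq> d 0 ` tuples (J (Suc 0)) UNIV"
      using aug \<phi>(2)[of 0] unfolding A.cyc_eq[symmetric] A.cyc_0 by blast
    then obtain s where s: "rhom s" "s ` tuples (J 0) UNIV \<subseteq> tuples (J (Suc 0)) UNIV"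
        "\<And>z. z \<in> tuples (J 0) UNIV \<Longrightarrow> d 0 (s z) = \<phi> 0 z"
      by (rule hom_lift[OF A.fin \<phi>(1) A.d_hom]) blast
    have "\<phi> (Suc 0) z - s (d 0 z) \<in> A.cyc (Suc 0)" if z: "z \<in> tuples (J (Suc 0)) UNIV" for z
    proof -
      have dz: "d 0 z \<in> tuples (J 0) UNIV" by (rule A.d_in[OF z])
      have "d 0 (\<phi> (Suc 0) z - s (d 0 z)) = 0"
        by (simp add: module_hom.diff[OF A.d_hom] chain[OF z] s(3)[OF dz])
      moreover have "\<phi> (Suc 0) z - s (d 0 z) \<in> tuples (J (Suc 0)) UNIV"
        using \<phi>(2)[of "Suc 0"] s(2) dz z by (intro diff) auto
      ultimately show ?thesis by (simp add: A.cyc_Suc)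
    qed
    thus "\<exists>s. P 0 s" using s by (intro exI[of _ s]) (simp add: P_def)
  next
    fix s i assume P: "P i s"
    note s = P[unfolded P_def, THEN conjunct1]
    define \<chi> where "\<chi> z = \<phi> (Suc i) z - s (d i z)" for z
    have \<chi>: "rhom \<chi>"
      unfolding \<chi>_def
      by (rule module_pair.module_hom_sub[OF module_pair_smul \<phi>(1) module_hom_compose[OF A.d_hom s, unfolded comp_def]])
    have "\<chi> ` tuples (J (Suc i)) UNIV \<subseteq> d (Suc i) ` tuples (J (Suc (Suc i))) UNIV"
      using P unfolding P_def A.cyc_eq \<chi>_def by blast
    then obtain t where t: "rhom t" "t ` tuples (J (Suc i)) UNIV \<subseteq> tuples (J (Suc (Suc i))) UNIV"
        "\<And>z. z \<in> tuples (J (Suc i)) UNIV \<Longrightarrow> d (Suc i) (t z) = \<chi> z"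
      by (rule hom_lift[OF A.fin \<chi> A.d_hom]) blast
    have "\<phi> (Suc (Suc i)) z - t (d (Suc i) z) \<in> A.cyc (Suc (Suc i))"
      if z: "z \<in> tuples (J (Suc (Suc i))) UNIV" for z
    proof -
      have dz: "d (Suc i) z \<in> tuples (J (Suc i)) UNIV" by (rule A.d_in[OF z])
      have "d (Suc i) (\<phi> (Suc (Suc i)) z - t (d (Suc i) z)) = 0"
        by (simp add: module_hom.diff[OF A.d_hom] chain[OF z] t(3)[OF dz] \<chi>_def A.d_d[OF z]
            module_hom.zero[OF s])
      moreover have "\<phi> (Suc (Suc i)) z - t (d (Suc i) z) \<in> tuples (J (Suc (Suc i))) UNIV"
        using \<phi>(2)[of "Suc (Suc i)"] t(2) dz z by (intro diff) auto
      ultimately show ?thesis by (simp add: A.cyc_Suc)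
    qed
    hence "P (Suc i) t" using t(1,2) by (simp add: P_def)
    moreover have "Q i s t" using t(3) by (simp add: Q_def \<chi>_def)
    ultimately show "\<exists>t. P (Suc i) t \<and> Q i s t" by blast
  qed
  then obtain s where s: "\<And>i. P i (s i)" "\<And>i. Q i (s i) (s (Suc i))" by blast
  have eq: "d i (s i z) = \<phi> i z"
    if "z \<in> tuples (J i) UNIV" "\<forall>k. i = Suc k \<longrightarrow> d k z = 0" for i z
  proof (cases i)
    case 0
    thus ?thesis using s(1)[of i] that(1) by (simp add: P_def)
  next
    case (Suc k)
    have "rhom (s k)" using s(1)[of k] by (simp add: P_def)
    hence "s k 0 = 0" by (rule module_hom.zero)
    thus ?thesis using s(2)[of k] that Suc by (simp add: Q_def)
  qed
  show ?thesis
  proof (rule that)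
    show "rhom (s i)" "s i ` tuples (J i) UNIV \<subseteq> tuples (J (Suc i)) UNIV" for i
      using s(1)[of i] by (simp_all add: P_def)
  qed (rule eq)
qed

text \<open>In homological degree \<open>0\<close> every element is a cycle.\<close>
definition cycles_bound :: "(nat \<Rightarrow> 'a set) \<Rightarrow> (nat \<Rightarrow> ('a \<Rightarrow> 'r::comm_ring_1) \<Rightarrow> 'a \<Rightarrow> 'r)
    \<Rightarrow> 'r set \<Rightarrow> 'r set \<Rightarrow> bool" where
  "cycles_bound J d M N \<longleftrightarrow> (\<forall>i. \<forall>z\<in>tuples (J i) M. (\<forall>k. i = Suc k \<longrightarrow> d k z = 0)
     \<longrightarrow> (\<exists>y\<in>tuples (J (Suc i)) N. d i y = z))"

text \<open>
  Let \<open>f\<close> and \<open>g\<close> be comparison maps to and from the second resolution. The cycle \<open>f z\<close> is the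
  boundary of some \<open>y\<close> over \<open>N\<close>, and \<open>g f z\<close> differs from \<open>z\<close> by the boundary of \<open>s z\<close>, which has
  entries in \<open>M \<subseteq> N\<close>. Hence \<open>z\<close> is the boundary of \<open>g y - s z\<close>.
\<close>
lemma cycles_bound_transfer:
  assumes A: "based_resolution J d aug sc U" and B: "based_resolution J' d' aug' sc U"
    and M: "is_ideal M" and N: "is_ideal N" and MN: "M \<subseteq> N"
    and bound: "cycles_bound J' d' M N"
  shows "cycles_bound J d M N"
  unfolding cycles_bound_def
proof (intro allI ballI impI)
  interpret A: based_resolution J d aug sc U by (rule A)
  interpret B: based_resolution J' d' aug' sc U by (rule B)
  obtain f where f: "\<And>i. rhom (f i)" "\<And>i. f i ` tuples (J i) UNIV \<subseteq> tuples (J' i) UNIV"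
      "\<And>z. z \<in> tuples (J 0) UNIV \<Longrightarrow> aug' (f 0 z) = aug z"
      "\<And>i z. z \<in> tuples (J (Suc i)) UNIV \<Longrightarrow> d' i (f (Suc i) z) = f i (d i z)"
    using that by (rule comparison_map[OF A B])
  obtain g where g: "\<And>i. rhom (g i)" "\<And>i. g i ` tuples (J' i) UNIV \<subseteq> tuples (J i) UNIV"
      "\<And>z. z \<in> tuples (J' 0) UNIV \<Longrightarrow> aug (g 0 z) = aug' z"
      "\<And>i z. z \<in> tuples (J' (Suc i)) UNIV \<Longrightarrow> d i (g (Suc i) z) = g i (d' i z)"
    using that by (rule comparison_map[OF B A])
  define \<phi> where "\<phi> i z = g i (f i z) - z" for i z
  have f_in: "f i z \<in> tuples (J' i) UNIV" if "z \<in> tuples (J i) UNIV" for i z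
    using f(2)[of i] that by (simp add: image_subset_iff)
  have g_in: "g i z \<in> tuples (J i) UNIV" if "z \<in> tuples (J' i) UNIV" for i z
    using g(2)[of i] that by (simp add: image_subset_iff)
  have \<phi>_hom: "rhom (\<phi> i)" for i
    unfolding \<phi>_def
    by (rule module_pair.module_hom_sub[OF module_pair_smul module_hom_compose[OF f(1) g(1), unfolded comp_def]
          module.module_hom_ident[OF module_smul]])
  have \<phi>_maps: "\<phi> i ` tuples (J i) UNIV \<subseteq> tuples (J i) UNIV" for i
    unfolding \<phi>_def by (rule image_subsetI) (intro tuples_diff[OF is_ideal_UNIV] g_in f_in)
  have \<phi>_aug: "aug (\<phi> 0 z) = 0" if "z \<in> tuples (J 0) UNIV" for z
    using that by (simp add: \<phi>_def module_hom.diff[OF A.aug_hom] g(3) f(3) f_in)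
  have \<phi>_chain: "d i (\<phi> (Suc i) z) = \<phi> i (d i z)" if "z \<in> tuples (J (Suc i)) UNIV" for i z
    using that by (simp add: \<phi>_def module_hom.diff[OF A.d_hom] g(4) f(4) f_in)
  obtain s where s: "\<And>i. rhom (s i)" "\<And>i. s i ` tuples (J i) UNIV \<subseteq> tuples (J (Suc i)) UNIV"
    "\<And>i z. z \<in> tuples (J i) UNIV \<Longrightarrow> \<forall>k. i = Suc k \<longrightarrow> d k z = 0 \<Longrightarrow> d i (s i z) = \<phi> i z"
    using \<phi>_aug \<phi>_chain that by (rule comparison_homotopy[OF A \<phi>_hom \<phi>_maps])
  fix i z assume z: "z \<in> tuples (J i) M" and cycle: "\<forall>k. i = Suc k \<longrightarrow> d k z = 0"
  have zU: "z \<in> tuples (J i) UNIV" using z tuples_mono[of M UNIV] by blast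
  have fz: "f i z \<in> tuples (J' i) M" by (rule hom_tuples[OF f(1,2) A.fin M z])
  have "d' k (f i z) = 0" if "i = Suc k" for k
    using f(4)[of z k] zU cycle by (simp add: that module_hom.zero[OF f(1)])
  hence dz: "\<forall>k. i = Suc k \<longrightarrow> d' k (f i z) = 0" by blast
  with fz have "\<exists>y\<in>tuples (J' (Suc i)) N. d' i y = f i z"
    using bound by (simp add: cycles_bound_def)
  then obtain y where y: "y \<in> tuples (J' (Suc i)) N" "d' i y = f i z" ..
  have "g (Suc i) y \<in> tuples (J (Suc i)) N" by (rule hom_tuples[OF g(1,2) B.fin N y(1)])
  moreover have "s i z \<in> tuples (J (Suc i)) N"
    by (rule hom_tuples[OF s(1,2) A.fin N subsetD[OF tuples_mono[OF MN] z]])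
  ultimately have in_N: "g (Suc i) y - s i z \<in> tuples (J (Suc i)) N" by (rule tuples_diff[OF N])
  have "y \<in> tuples (J' (Suc i)) UNIV" using y(1) tuples_mono[of N UNIV] by blast
  hence "d i (g (Suc i) y - s i z) = z"
    by (simp add: module_hom.diff[OF A.d_hom] g(4) y(2) s(3)[OF zU cycle] \<phi>_def)
  thus "\<exists>y\<in>tuples (J (Suc i)) N. d i y = z" using in_N by (rule bexI)
qed

section \<open>The Koszul complex as a resolution of the residue field\<close>

lemma lookup_mult_0:
  fixes f g :: "('x, 'k::field) mpoly"
  shows "Poly_Mapping.lookup (f * g) 0 = Poly_Mapping.lookup f 0 * Poly_Mapping.lookup g 0"
proof -
  have 0: "0 = l + q \<longleftrightarrow> q = 0 \<and> l = 0" for l q :: "'x \<Rightarrow>\<^sub>0 nat"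
  proof
    assume *: "0 = l + q"
    have "Poly_Mapping.lookup l i = 0 \<and> Poly_Mapping.lookup q i = 0" for i
      using arg_cong[OF *, of "\<lambda>c. Poly_Mapping.lookup c i"] by (simp add: lookup_add)
    thus "q = 0 \<and> l = 0" by (auto intro: poly_mapping_eqI)
  qed simp
  have "(\<Sum>q. Poly_Mapping.lookup g q when 0 = l + q) = (Poly_Mapping.lookup g 0 when l = 0)" for l
    unfolding 0 by (cases "l = 0") simp_all
  thus ?thesis by (simp add: lookup_mult mult_when)
qed

lemma module_residue_scale: "module (residue_scale :: ('x::finite, 'k::field) mpoly \<Rightarrow> 'k \<Rightarrow> 'k)"
  by unfold_locales
     (simp_all add: residue_scale_def lookup_add lookup_mult_0 algebra_simps)

lemma rhom_kdiff: "rhom kdiff"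
  by (rule module_homI[OF module_smul module_smul])
     (simp_all add: fun_eq_iff kdiff_def smul_def distrib_left sum.distrib sum_distrib_left ac_simps)

lemma koszul_resolution:
  "based_resolution (faces :: nat \<Rightarrow> 'x::finite set set) (\<lambda>_. kdiff)
     (\<lambda>z. Poly_Mapping.lookup (z {} :: ('x, 'k::field) mpoly) 0) residue_scale UNIV"
proof (rule based_resolution.intro)
  show "finite (faces i :: 'x set set)" for i by simp
  show "rhom (kdiff :: _ \<Rightarrow> _ \<Rightarrow> ('x, 'k) mpoly)" by (rule rhom_kdiff)
  show "module_hom smul residue_scale (\<lambda>z. Poly_Mapping.lookup (z {} :: ('x, 'k) mpoly) 0)"
    by (rule module_homI[OF module_smul module_residue_scale])
       (simp_all add: smul_def residue_scale_def lookup_add lookup_mult_0)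
  show "(\<lambda>z. Poly_Mapping.lookup (z {} :: ('x, 'k) mpoly) 0) ` tuples (faces 0) UNIV = UNIV"
  proof (intro set_eqI iffI UNIV_I)
    fix c :: 'k
    show "c \<in> (\<lambda>z. Poly_Mapping.lookup (z {} :: ('x, 'k) mpoly) 0) ` tuples (faces 0) UNIV"
      by (rule image_eqI[of _ _ "\<lambda>S. if S = {} then Poly_Mapping.single 0 c else 0"])
         (auto simp: tuples_def faces_def)
  qed
  have const: "Poly_Mapping.lookup (kdiff y {} :: ('x, 'k) mpoly) 0 = 0" for y
    unfolding kdiff_def
    by (intro max_ideal_const ideal_sum ideal_mult ideal_mult_right var_in_max_ideal is_ideal_max_ideal)
  show "{z \<in> tuples (faces 0) UNIV. Poly_Mapping.lookup (z {} :: ('x, 'k) mpoly) 0 = 0}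
      = kdiff ` tuples (faces (Suc 0)) UNIV"
  proof (intro set_eqI iffI)
    fix z :: "'x set \<Rightarrow> ('x, 'k) mpoly"
    assume "z \<in> {z \<in> tuples (faces 0) UNIV. Poly_Mapping.lookup (z {}) 0 = 0}"
    thus "z \<in> kdiff ` tuples (faces (Suc 0)) UNIV"
      using koszul_exact[of z 0] kdiff_faces_0[of z UNIV] by auto
  qed (auto simp: const intro: kdiff_tuples[OF is_ideal_UNIV])
  show "{z \<in> tuples (faces (Suc i)) UNIV. kdiff z = 0}
      = kdiff ` tuples (faces (Suc (Suc i))) (UNIV :: ('x, 'k) mpoly set)" for i
  proof (intro set_eqI iffI)
    fix z :: "'x set \<Rightarrow> ('x, 'k) mpoly"
    assume z: "z \<in> {z \<in> tuples (faces (Suc i)) UNIV. kdiff z = 0}"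
    hence "z {} = 0" by (auto simp: tuples_def faces_def)
    thus "z \<in> kdiff ` tuples (faces (Suc (Suc i))) UNIV"
      using koszul_exact[of z "Suc i"] z by auto
  qed (auto simp: kdiff_kdiff intro: kdiff_tuples[OF is_ideal_UNIV])
qed


section \<open>From Koszul homology to Tor\<close>

lemma tensor_part_eq: "tensor_part C M i = tuples {..<rk C i} M"
  by (auto simp: tensor_part_def tuples_def not_less)

lemma rhom_tensor_diff: "rhom (tensor_diff C (*) i)"
  by (rule module_homI[OF module_smul module_smul])
     (simp_all add: fun_eq_iff tensor_diff_def smul_def distrib_left sum.distrib sum_distrib_left ac_simps)

lemma augmentation_hom:
  assumes "module sc" shows "module_hom smul sc (augmentation C e sc)"
proof -
  interpret module sc by (rule assms)
  show ?thesis
    by (rule module_homI[OF module_smul assms])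
       (simp_all add: augmentation_def smul_def scale_left_distrib sum.distrib scale_sum_right)
qed

lemma free_resolution_based:
  assumes sc: "module sc" and res: "free_resolution C e sc M"
  shows "based_resolution (\<lambda>i. {..<rk C i}) (\<lambda>i. tensor_diff C (*) (Suc i)) (augmentation C e sc) sc M"
proof (rule based_resolution.intro)
  show "{z \<in> tuples {..<rk C (Suc i)} UNIV. tensor_diff C (*) (Suc i) z = 0}
      = tensor_diff C (*) (Suc (Suc i)) ` tuples {..<rk C (Suc (Suc i))} UNIV" for i
    using res by (simp add: free_resolution_def tensor_part_eq)
qed (use res in \<open>simp_all add: free_resolution_def tensor_part_eq rhom_tensor_diff augmentation_hom[OF sc]\<close>)

lemma tor_vanishing_of_koszul_vanishing:
  fixes M N :: "('x::finite, 'k::field) mpoly set"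
  assumes M: "is_ideal M" and N: "is_ideal N" and MN: "M \<subseteq> N" and van: "koszul_vanishing M N"
  shows "tor_vanishing (*) M (*) N (\<lambda>x. x)"
  unfolding tor_vanishing_def
proof (intro conjI allI impI ballI)
  show "linear_map_on (*) M (*) N (\<lambda>x. x)" using MN by (auto simp: linear_map_on_def)
next
  fix C :: "('x, 'k) mpoly free_complex" and e :: "nat \<Rightarrow> 'k" and i c
  assume res: "free_resolution C e residue_scale (UNIV :: 'k set)" and c: "c \<in> Tor C (*) M i"
  have "cycles_bound faces (\<lambda>_. kdiff) M N"
    using van kdiff_faces_0 unfolding cycles_bound_def koszul_vanishing_def by (metis not0_implies_Suc)
  hence bound: "cycles_bound (\<lambda>i. {..<rk C i}) (\<lambda>i. tensor_diff C (*) (Suc i)) M N"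
    by (rule cycles_bound_transfer[OF free_resolution_based[OF module_residue_scale res]
          koszul_resolution M N MN])
  let ?B = "\<lambda>L. Tor_zero_class C (*) L i"
  have B: "?B L = tensor_diff C (*) (Suc i) ` tuples {..<rk C (Suc i)} L" for L
    by (auto simp: Tor_zero_class_def boundaries_def tensor_part_eq)
  note d = rhom_tensor_diff[of C "Suc i"]
  have B_zero: "0 \<in> ?B M"
    unfolding B using M
    by (intro image_eqI[of _ _ 0]) (auto simp: module_hom.zero[OF d] tuples_def ideal_zero)
  have B_add: "y + z \<in> ?B N" if "y \<in> ?B N" "z \<in> ?B N" for y z
    using that N unfolding B
    by (auto simp: tuples_def ideal_add module_hom.add[OF d, symmetric] intro!: imageI)
  have B_neg: "- y \<in> ?B N" if "y \<in> ?B N" for y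
    using that N unfolding B
    by (auto simp: tuples_def ideal_neg module_hom.neg[OF d, symmetric] intro!: imageI)
  have BMN: "?B M \<subseteq> ?B N" unfolding B by (intro image_mono tuples_mono MN)
  obtain z where z: "z \<in> cycles (tensor_part C M) (\<lambda>_. {0}) (tensor_diff C (*)) i"
      "c = (\<lambda>b. z + b) ` ?B M"
    using c by (auto simp: Tor_def homology_def Tor_zero_class_def)
  have "z \<in> tuples {..<rk C i} M" "\<forall>k. i = Suc k \<longrightarrow> tensor_diff C (*) (Suc k) z = 0"
    using z(1) by (auto simp: cycles_def tensor_part_eq)
  hence "z \<in> ?B N" using bound unfolding cycles_bound_def B by blast
  hence cN: "c \<subseteq> ?B N" using z(2) B_add BMN by blast
  have "z \<in> c" using z(2) B_zero by force
  show "Tor_map C (*) N (\<lambda>x. x) i c = ?B N"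
  proof (intro equalityI subsetI)
    fix y assume "y \<in> Tor_map C (*) N (\<lambda>x. x) i c"
    thus "y \<in> ?B N" using cN B_add by (auto simp: Tor_map_def comp_def)
  next
    fix y assume "y \<in> ?B N"
    moreover have "y = z + (- z + y)" by simp
    ultimately show "y \<in> Tor_map C (*) N (\<lambda>x. x) i c"
      unfolding Tor_map_def comp_def using \<open>z \<in> c\<close> \<open>z \<in> ?B N\<close> B_add B_neg by blast
  qed
qed

section \<open>Koszul modules\<close>

lemma hom_tuples_prod:
  assumes f: "rhom f" "f ` tuples J UNIV \<subseteq> tuples J' B" and J: "finite J" and B: "is_ideal B"
    and z: "z \<in> tuples J A"
  shows "f z \<in> tuples J' (ideal_prod A B)"
proof (rule tuplesI)
  fix i
  have basis: "f (basis j) \<in> tuples J' B" if "j \<in> J" for j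
    using f(2) basis_tuples[OF that] by blast
  show "f z i \<in> ideal_prod A B"
    unfolding hom_tuples_expand[OF f(1) J z] sum_fun_apply smul_def
    by (intro ideal_sum[OF is_ideal_ideal_prod] ideal_prodI tuples_in[OF basis B])
       (use z in \<open>auto simp: tuples_def\<close>)
  show "f z i = 0" if "i \<notin> J'"
    using f(2) z tuples_mono[of A UNIV J] tuples_outside[OF _ that] by blast
qed

lemma kdiff_tuples_prod:
  fixes z :: "'x::finite set \<Rightarrow> ('x, 'k::field) mpoly"
  assumes "z \<in> tuples (faces (Suc i)) A"
  shows "kdiff z \<in> tuples (faces i) (ideal_prod A max_ideal)"
proof (rule hom_tuples_prod[OF rhom_kdiff _ _ is_ideal_max_ideal assms])
  have "kdiff y \<in> tuples (faces i) max_ideal" if y: "y \<in> tuples (faces (Suc i)) UNIV"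
    for y :: "'x set \<Rightarrow> ('x, 'k) mpoly"
  proof (rule tuplesI)
    show "kdiff y S \<in> max_ideal" for S
      unfolding kdiff_def
      by (intro ideal_sum ideal_mult ideal_mult_right var_in_max_ideal is_ideal_max_ideal)
    show "kdiff y S = 0" if "S \<notin> faces i" for S
      using kdiff_tuples[OF is_ideal_UNIV y] that by (rule tuples_outside)
  qed
  thus "(kdiff :: _ \<Rightarrow> 'x set \<Rightarrow> ('x, 'k) mpoly) ` tuples (faces (Suc i)) UNIV
      \<subseteq> tuples (faces i) max_ideal"
    by (rule image_subsetI)
qed (simp add: faces_def)

text \<open>
  The vanishing of \<open>H\<^sub>i\<^sub>+\<^sub>1(lin X)\<close> in the single summand \<open>\<F>\<^sup>p / \<F>\<^sup>p\<^sup>+\<^sup>1\<close>: the cycle \<open>w\<close> is put into the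
  family that is \<open>0\<close> at all other filtration indices.
\<close>
lemma linearity_defect_zeroD:
  fixes X :: "('x::finite, 'k::field) mpoly free_complex"
  assumes ld: "linearity_defect X = 0" and w: "w \<in> Filt X p (Suc i)"
    and dw: "tensor_diff X (*) (Suc i) w \<in> Filt X (Suc p) i"
  shows "\<exists>v\<in>Filt X p (Suc (Suc i)). w - tensor_diff X (*) (Suc (Suc i)) v \<in> Filt X (Suc p) (Suc i)"
proof -
  let ?B = "boundaries (lin_num X) (lin_den X) (lin_diff X) (Suc i)"
  have "enat (Suc i) \<le> linearity_defect X"
    if "\<not> homology_zero (lin_num X) (lin_den X) (lin_diff X) (Suc i)"
    unfolding linearity_defect_def by (rule Sup_upper) (use that in blast)
  hence hz: "homology_zero (lin_num X) (lin_den X) (lin_diff X) (Suc i)"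
    using ld by (auto simp: zero_enat_def)
  have zero_Filt: "0 \<in> Filt X q j" for q j
    by (simp add: Filt_def tensor_part_def ideal_zero[OF is_ideal_ideal_pow])
  have d0: "tensor_diff X (*) j 0 = 0" for j by (rule module_hom.zero[OF rhom_tensor_diff])
  define u where "u = (\<lambda>q. if q = p then w else 0)"
  have fin: "finite {q. (if q = p then y else 0) \<noteq> 0}" for y :: "nat \<Rightarrow> ('x, 'k) mpoly"
    by (rule finite_subset[of _ "{p}"]) auto
  have "u \<in> lin_num X (Suc i)"
    using w fin[of w] by (auto simp: lin_num_def u_def zero_Filt)
  moreover have "lin_diff X (Suc i) u = (\<lambda>q. if q = p then tensor_diff X (*) (Suc i) w else 0)"
    by (auto simp: lin_diff_def u_def d0)
  hence "lin_diff X (Suc i) u \<in> lin_den X i"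
    using dw fin[of "tensor_diff X (*) (Suc i) w"] by (auto simp: lin_den_def zero_Filt)
  ultimately have "u \<in> cycles (lin_num X) (lin_den X) (lin_diff X) (Suc i)"
    by (simp add: cycles_def)
  hence "(\<lambda>b. u + b) ` ?B \<in> homology (lin_num X) (lin_den X) (lin_diff X) (Suc i)"
    unfolding homology_def by (rule imageI)
  hence "(\<lambda>b. u + b) ` ?B = ?B" using hz by (simp add: homology_zero_def)
  moreover have "0 \<in> ?B"
    unfolding boundaries_def
    by (rule CollectI, rule exI[of _ 0], rule exI[of _ 0])
       (simp add: lin_num_def lin_den_def lin_diff_def zero_Filt d0 fun_eq_iff)
  ultimately have "u \<in> ?B" by force
  then obtain y n where yn: "u = lin_diff X (Suc (Suc i)) y + n"
      "y \<in> lin_num X (Suc (Suc i))" "n \<in> lin_den X (Suc i)"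
    by (auto simp: boundaries_def)
  have "w = tensor_diff X (*) (Suc (Suc i)) (y p) + n p"
    using fun_cong[OF yn(1), of p] by (simp add: u_def lin_diff_def)
  hence "w - tensor_diff X (*) (Suc (Suc i)) (y p) = n p" by simp
  thus ?thesis using yn(2,3) by (intro bexI[of _ "y p"]) (auto simp: lin_num_def lin_den_def)
qed

text \<open>
  Linearity defect \<open>0\<close> in the form that a chase of elements needs, without associated graded modules:
  the differential is strict for the filtrations \<open>\<F>\<close> of the resolution.
\<close>

locale linear_resolution = based_resolution J d aug "(*)" P
  for J :: "nat \<Rightarrow> 'a set" and d :: "nat \<Rightarrow> ('a \<Rightarrow> ('x::finite, 'k::field) mpoly) \<Rightarrow> 'a \<Rightarrow> ('x, 'k) mpoly"
    and aug :: "('a \<Rightarrow> ('x, 'k) mpoly) \<Rightarrow> ('x, 'k) mpoly" and P +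
  assumes minimal: "d i ` tuples (J (Suc i)) UNIV \<subseteq> tuples (J i) max_ideal"
    and strict: "y \<in> cyc i \<Longrightarrow> y \<in> tuples (J i) (ideal_pow max_ideal (Suc a)) \<Longrightarrow>
      \<exists>w\<in>tuples (J (Suc i)) (ideal_pow max_ideal a). d i w = y"

text \<open>
  By induction the boundary \<open>y \<in> \<mm>\<^sup>b\<^sup>+\<^sup>2 Y\<^sub>i\<close> is \<open>d w\<close> with \<open>w \<in> \<mm>\<^sup>b Y\<^sub>i\<^sub>+\<^sub>1\<close>. Then \<open>w\<close> lies in
  \<open>\<F>\<^sup>b\<^sup>+\<^sup>i\<^sup>+\<^sup>1\<close> and \<open>d w\<close> lies one step deeper in the filtration, so \<open>w\<close> is a cycle of \<open>lin\<close>. As this is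
  acyclic, \<open>w\<close> can be corrected by a boundary to an element of \<open>\<mm>\<^sup>b\<^sup>+\<^sup>1 Y\<^sub>i\<^sub>+\<^sub>1\<close>, which does not change
  \<open>d w\<close>.
\<close>
lemma koszul_module_linear_resolution:
  assumes "koszul_module (*) P gr"
  shows "\<exists>X e. linear_resolution (\<lambda>i. {..<rk X i}) (\<lambda>i. tensor_diff X (*) (Suc i))
    (augmentation X e (*)) P"
proof -
  obtain X a e where min: "minimal_graded_free_resolution X a e (*) P gr" and ld: "linearity_defect X = 0"
    using assms by (auto simp: koszul_module_def)
  have res: "free_resolution X e (*) P" using min by (simp add: minimal_graded_free_resolution_def)
  interpret Y: based_resolution "\<lambda>i. {..<rk X i}" "\<lambda>i. tensor_diff X (*) (Suc i)"
    "augmentation X e (*)" "(*)" P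
    by (rule free_resolution_based[OF module_mult res])
  have strict: "\<exists>w\<in>tuples {..<rk X (Suc i)} (ideal_pow max_ideal b). tensor_diff X (*) (Suc i) w = y"
    if "y \<in> Y.cyc i" "y \<in> tuples {..<rk X i} (ideal_pow max_ideal (Suc b))" for y i b
    using that
  proof (induction b)
    case 0
    thus ?case unfolding Y.cyc_eq by auto
  next
    case (Suc b)
    have "y \<in> tuples {..<rk X i} (ideal_pow max_ideal (Suc b))"
      using Suc.prems(2) tuples_mono[OF ideal_pow_antimono[of "Suc b" "Suc (Suc b)"]] by auto
    then obtain w where w: "w \<in> tuples {..<rk X (Suc i)} (ideal_pow max_ideal b)"
        "tensor_diff X (*) (Suc i) w = y"
      using Suc.IH Suc.prems(1) by blast
    let ?p = "b + Suc i"
    have "w \<in> Filt X ?p (Suc i)" using w(1) by (simp add: Filt_def tensor_part_eq)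
    moreover have "tensor_diff X (*) (Suc i) w \<in> Filt X (Suc ?p) i"
      using w(2) Suc.prems(2) by (simp add: Filt_def tensor_part_eq Suc_diff_le)
    ultimately obtain v where v: "v \<in> Filt X ?p (Suc (Suc i))"
        "w - tensor_diff X (*) (Suc (Suc i)) v \<in> Filt X (Suc ?p) (Suc i)"
      using linearity_defect_zeroD[OF ld] by blast
    have vU: "v \<in> tuples {..<rk X (Suc (Suc i))} UNIV"
      using v(1) tuples_mono[of _ UNIV] by (auto simp: Filt_def tensor_part_eq)
    show ?case
    proof
      show "tensor_diff X (*) (Suc i) (w - tensor_diff X (*) (Suc (Suc i)) v) = y"
        by (simp add: module_hom.diff[OF rhom_tensor_diff] w(2) Y.d_d[OF vU])
      show "w - tensor_diff X (*) (Suc (Suc i)) v \<in> tuples {..<rk X (Suc i)} (ideal_pow max_ideal (Suc b))"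
        using v(2) by (simp add: Filt_def tensor_part_eq Suc_diff_le)
    qed
  qed
  have "linear_resolution (\<lambda>i. {..<rk X i}) (\<lambda>i. tensor_diff X (*) (Suc i)) (augmentation X e (*)) P"
  proof (rule linear_resolution.intro[OF Y.based_resolution_axioms], rule linear_resolution_axioms.intro)
    have m: "\<forall>i\<ge>1. tensor_diff X (*) i ` tensor_part X UNIV i \<subseteq> tensor_part X max_ideal (i - 1)"
      using min by (simp add: minimal_graded_free_resolution_def)
    show "tensor_diff X (*) (Suc i) ` tuples {..<rk X (Suc i)} UNIV \<subseteq> tuples {..<rk X i} max_ideal" for i
      using m[rule_format, of "Suc i"] by (simp add: tensor_part_eq)
  qed (rule strict)
  thus ?thesis by blast
qed

text \<open>\<open>K\<^sub>i \<otimes> Y\<^sub>j\<close> consists of families of elements of \<open>K\<^sub>i\<close> indexed by the basis of \<open>Y\<^sub>j\<close>.\<close>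

definition bituples :: "'b set \<Rightarrow> 'a set \<Rightarrow> 'm::zero set \<Rightarrow> ('a \<Rightarrow> 'b \<Rightarrow> 'm) set" where
  "bituples F J M = {Z. (\<forall>c S. Z c S \<in> M) \<and> (\<forall>c S. c \<notin> J \<or> S \<notin> F \<longrightarrow> Z c S = 0)}"

lemma bituples_row: "Z \<in> bituples F J M \<Longrightarrow> Z c \<in> tuples F M"
  by (simp add: bituples_def tuples_def)

lemma bituples_column: "Z \<in> bituples F J M \<Longrightarrow> (\<lambda>c. Z c S) \<in> tuples J M"
  by (simp add: bituples_def tuples_def)

lemma bituples_from_rows:
  assumes "\<And>c. Z c \<in> tuples F M" "\<And>c. c \<notin> J \<Longrightarrow> Z c = 0" "is_ideal M"
  shows "Z \<in> bituples F J M"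
  using assms by (auto simp: bituples_def intro: tuples_in[OF assms(1,3)] tuples_outside)

lemma bituples_from_columns:
  assumes "\<And>S. (\<lambda>c. Z c S) \<in> tuples J M" "\<And>c S. S \<notin> F \<Longrightarrow> Z c S = 0" "is_ideal M"
  shows "Z \<in> bituples F J M"
  using assms(2) tuples_in[OF assms(1,3)] tuples_outside[OF assms(1)] by (auto simp: bituples_def)

lemma hom_kdiff_commute:
  assumes f: "module_hom smul sc f"
  shows "f (\<lambda>c. kdiff (Z c) S) = (\<Sum>j\<in>-S. sc (sgn_ins j S * var j) (f (\<lambda>c. Z c (insert j S))))"
proof -
  have "(\<lambda>c. kdiff (Z c) S) = (\<Sum>j\<in>-S. smul (sgn_ins j S * var j) (\<lambda>c. Z c (insert j S)))"
    by (rule ext) (simp add: kdiff_def sum_fun_apply smul_def mult.assoc)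
  thus ?thesis by (simp add: module_hom.sum[OF f] module_hom.scale[OF f])
qed

lemma rhom_kdiff_commute:
  assumes f: "rhom f"
  shows "f (\<lambda>c. kdiff (Z c) S) r = kdiff (\<lambda>T. f (\<lambda>c. Z c T) r) S"
  unfolding hom_kdiff_commute[OF f] by (simp add: kdiff_def sum_fun_apply smul_def mult.assoc)

lemma functional_kdiff_commute:
  assumes f: "module_hom smul (*) f"
  shows "f (\<lambda>c. kdiff (Z c) S) = kdiff (\<lambda>T. f (\<lambda>c. Z c T)) S"
  unfolding hom_kdiff_commute[OF f] by (simp add: kdiff_def mult.assoc)

lemma koszul_rows_bound:
  fixes Z :: "'a \<Rightarrow> 'x::finite set \<Rightarrow> ('x, 'k::field) mpoly"
  assumes Z: "Z \<in> bituples (faces i) J (ideal_pow max_ideal (Suc q))"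
    and cycle: "\<And>c. kdiff (Z c) = 0"
  shows "\<exists>W\<in>bituples (faces (Suc i)) J (ideal_pow max_ideal q). \<forall>c. kdiff (W c) = Z c"
proof -
  have "\<exists>y. y \<in> tuples (faces (Suc i)) (ideal_pow max_ideal q) \<and> kdiff y = Z c" for c
    using koszul_vanishing_max_ideal_pow[of q] bituples_row[OF Z] cycle[of c]
    unfolding koszul_vanishing_def by blast
  then obtain y where y: "\<And>c. y c \<in> tuples (faces (Suc i)) (ideal_pow max_ideal q)"
      "\<And>c. kdiff (y c) = Z c" by metis
  define W where "W c = (if c \<in> J then y c else 0)" for c
  have "W \<in> bituples (faces (Suc i)) J (ideal_pow max_ideal q)"
    using y(1) by (intro bituples_from_rows is_ideal_ideal_pow)
      (auto simp: W_def tuples_def ideal_zero[OF is_ideal_ideal_pow])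
  moreover have "kdiff (W c) = Z c" for c
  proof (cases "c \<in> J")
    case False
    hence "Z c = 0" using Z by (auto simp: bituples_def)
    thus ?thesis using False by (simp add: W_def module_hom.zero[OF rhom_kdiff])
  qed (simp add: W_def y(2))
  ultimately show ?thesis by blast
qed

context linear_resolution
begin

lemma d_bituples:
  assumes "W \<in> bituples F (J (Suc j)) (ideal_pow max_ideal q)"
  shows "(\<lambda>c S. d j (\<lambda>c. W c S) c) \<in> bituples F (J j) (ideal_pow max_ideal (Suc q))"
proof (rule bituples_from_columns)
  show "(\<lambda>c. d j (\<lambda>c. W c S) c) \<in> tuples (J j) (ideal_pow max_ideal (Suc q))" for S
    using hom_tuples_prod[OF d_hom minimal fin is_ideal_max_ideal bituples_column[OF assms]]
    by (simp add: ideal_prod_commute)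
  show "d j (\<lambda>c. W c S) c = 0" if "S \<notin> F" for c S
  proof -
    have "(\<lambda>c. W c S) = 0" using assms that by (auto simp: bituples_def)
    thus ?thesis by (simp add: module_hom.zero[OF d_hom])
  qed
qed (rule is_ideal_ideal_pow)

text \<open>
  The induction on \<open>i\<close> runs along the double complex \<open>K \<otimes> Y\<close>, modulo \<open>B\<^sub>j = cyc j\<close>: the Koszul
  boundary of \<open>Z\<close> has entries in \<open>\<mm>\<^sup>q\<^sup>+\<^sup>2 Y\<^sub>j\<close>, so by strictness it is
  \<open>d Z'\<close> with \<open>Z'\<close> in \<open>K\<^sub>i\<^sub>-\<^sub>1 \<otimes> \<mm>\<^sup>q\<^sup>+\<^sup>1 Y\<^sub>j\<^sub>+\<^sub>1\<close>. The power of \<open>\<mm>\<close> is the same as before, because the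
  Koszul differential raises it and the passage to \<open>Y\<^sub>j\<^sub>+\<^sub>1\<close> lowers it. If \<open>W'\<close> is given by the induction
  hypothesis for \<open>Z'\<close>, then \<open>Z - d W'\<close> is a Koszul cycle. By minimality of \<open>Y\<close> its entries lie in
  \<open>\<mm>\<^sup>q\<^sup>+\<^sup>1\<close>, so that the vanishing for \<open>\<mm>\<^sup>q\<^sup>+\<^sup>1 \<subseteq> \<mm>\<^sup>q\<close> applies to it.
\<close>
lemma koszul_cycles_bound:
  assumes "Z \<in> bituples (faces i) (J j) (ideal_pow max_ideal (Suc q))"
    and "\<And>S. (\<lambda>c. kdiff (Z c) S) \<in> cyc j"
  shows "\<exists>W\<in>bituples (faces (Suc i)) (J j) (ideal_pow max_ideal q).
    \<forall>S. (\<lambda>c. Z c S - kdiff (W c) S) \<in> cyc j"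
  using assms
proof (induction i arbitrary: j Z)
  case 0
  have "kdiff (Z c) = 0" for c using bituples_row[OF 0(1)] by (rule kdiff_faces_0)
  then obtain W where W: "W \<in> bituples (faces (Suc 0)) (J j) (ideal_pow max_ideal q)"
      "\<And>c. kdiff (W c) = Z c"
    using koszul_rows_bound[OF 0(1)] by blast
  have "0 \<in> tuples (J (Suc j)) UNIV" by (simp add: tuples_def)
  hence "d j 0 \<in> cyc j" unfolding cyc_eq by (rule imageI)
  hence "0 \<in> cyc j" by (simp add: module_hom.zero[OF d_hom])
  hence "(\<lambda>c. 0) \<in> cyc j" unfolding zero_fun_def .
  thus ?case using W by (intro bexI[OF _ W(1)]) simp
next
  case (Suc i)
  note Z = Suc.prems
  have dZ: "kdiff (Z c) \<in> tuples (faces i) (ideal_pow max_ideal (Suc (Suc q)))" for c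
    using kdiff_tuples_prod[OF bituples_row[OF Z(1)], of c] by (simp add: ideal_prod_commute)
  have dZ_col: "(\<lambda>c. kdiff (Z c) S) \<in> tuples (J j) (ideal_pow max_ideal (Suc (Suc q)))" for S
  proof (rule tuplesI)
    show "kdiff (Z c) S \<in> ideal_pow max_ideal (Suc (Suc q))" for c
      by (rule tuples_in[OF dZ is_ideal_ideal_pow])
    show "kdiff (Z c) S = 0" if "c \<notin> J j" for c
    proof -
      have "Z c = 0" using Z(1) that by (auto simp: bituples_def)
      thus ?thesis by (simp add: module_hom.zero[OF rhom_kdiff])
    qed
  qed
  have "\<exists>w. w \<in> tuples (J (Suc j)) (ideal_pow max_ideal (Suc q)) \<and> d j w = (\<lambda>c. kdiff (Z c) S)" for S
    using strict[OF Z(2) dZ_col] by blast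
  then obtain w where w: "\<And>S. w S \<in> tuples (J (Suc j)) (ideal_pow max_ideal (Suc q))"
      "\<And>S. d j (w S) = (\<lambda>c. kdiff (Z c) S)" by metis
  define Z' where "Z' c S = (if S \<in> faces i then w S c else 0)" for c S
  have Z'_col: "(\<lambda>c. Z' c S) = (if S \<in> faces i then w S else 0)" for S
    by (auto simp: Z'_def)
  have Z': "Z' \<in> bituples (faces i) (J (Suc j)) (ideal_pow max_ideal (Suc q))"
  proof (rule bituples_from_columns[OF _ _ is_ideal_ideal_pow])
    show "(\<lambda>c. Z' c S) \<in> tuples (J (Suc j)) (ideal_pow max_ideal (Suc q))" for S
      unfolding Z'_col using w(1)
      by (auto simp: tuples_def ideal_zero[OF is_ideal_ideal_pow] simp del: ideal_pow.simps)
  qed (simp add: Z'_def)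
  have dZ': "d j (\<lambda>c. Z' c S) = (\<lambda>c. kdiff (Z c) S)" for S
  proof (cases "S \<in> faces i")
    case False
    thus ?thesis unfolding Z'_col
      using tuples_outside[OF dZ False] by (simp add: module_hom.zero[OF d_hom] fun_eq_iff)
  qed (simp add: Z'_col w(2))
  have "(\<lambda>c. kdiff (Z' c) S) \<in> cyc (Suc j)" for S
    unfolding cyc_Suc
  proof (intro CollectI conjI)
    show "(\<lambda>c. kdiff (Z' c) S) \<in> tuples (J (Suc j)) UNIV"
    proof (rule tuplesI)
      show "kdiff (Z' c) S = 0" if "c \<notin> J (Suc j)" for c
      proof -
        have "Z' c = 0" using Z' that by (auto simp: bituples_def)
        thus ?thesis by (simp add: module_hom.zero[OF rhom_kdiff])
      qed
    qed simp
    show "d j (\<lambda>c. kdiff (Z' c) S) = 0"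
    proof
      fix r
      have "d j (\<lambda>c. kdiff (Z' c) S) r = kdiff (kdiff (Z r)) S"
        unfolding rhom_kdiff_commute[OF d_hom] dZ' ..
      thus "d j (\<lambda>c. kdiff (Z' c) S) r = 0 r" by (simp add: kdiff_kdiff)
    qed
  qed
  then obtain W' where W': "W' \<in> bituples (faces (Suc i)) (J (Suc j)) (ideal_pow max_ideal q)"
      "\<And>S. (\<lambda>c. Z' c S - kdiff (W' c) S) \<in> cyc (Suc j)"
    using Suc.IH[OF Z'] by blast
  define V where "V = (\<lambda>c S. d j (\<lambda>c. W' c S) c)"
  have V: "V \<in> bituples (faces (Suc i)) (J j) (ideal_pow max_ideal (Suc q))"
    unfolding V_def by (rule d_bituples[OF W'(1)])
  have dV: "kdiff (V c) = kdiff (Z c)" for c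
  proof
    fix S
    have "d j ((\<lambda>c. Z' c S) - (\<lambda>c. kdiff (W' c) S)) = 0"
      using W'(2)[of S] by (simp add: cyc_Suc fun_diff_def)
    hence "d j (\<lambda>c. kdiff (W' c) S) = d j (\<lambda>c. Z' c S)"
      by (simp add: module_hom.diff[OF d_hom])
    hence "d j (\<lambda>c. kdiff (W' c) S) c = kdiff (Z c) S" by (simp add: dZ')
    thus "kdiff (V c) S = kdiff (Z c) S"
      by (simp add: V_def rhom_kdiff_commute[OF d_hom])
  qed
  have "Z - V \<in> bituples (faces (Suc i)) (J j) (ideal_pow max_ideal (Suc q))"
    using Z(1) V by (auto simp: bituples_def ideal_diff[OF is_ideal_ideal_pow] simp del: ideal_pow.simps)
  moreover have "kdiff ((Z - V) c) = 0" for c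
    by (simp add: module_hom.diff[OF rhom_kdiff] dV)
  ultimately obtain W where W: "W \<in> bituples (faces (Suc (Suc i))) (J j) (ideal_pow max_ideal q)"
      "\<And>c. kdiff (W c) = (Z - V) c"
    using koszul_rows_bound by blast
  have "(\<lambda>c. Z c S - kdiff (W c) S) \<in> cyc j" for S
  proof -
    have "(\<lambda>c. W' c S) \<in> tuples (J (Suc j)) UNIV"
      using bituples_column[OF W'(1)] tuples_mono[of _ UNIV] by blast
    hence "d j (\<lambda>c. W' c S) \<in> cyc j" unfolding cyc_eq by (rule imageI)
    moreover have "(\<lambda>c. Z c S - kdiff (W c) S) = d j (\<lambda>c. W' c S)"
      by (simp add: W(2) V_def)
    ultimately show ?thesis by simp
  qed
  thus ?case using W(1) by blast
qed

lemma ideal_prod_lift: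
  assumes "f \<in> ideal_prod A P" "is_ideal A"
  shows "\<exists>v\<in>tuples (J 0) A. aug v = f"
  using assms(1)[unfolded ideal_prod_def ideal_span_def]
proof (induction rule: module.span_induct_alt[OF module_mult, consumes 1, case_names base step])
  case base
  have "0 \<in> tuples (J 0) A" by (simp add: tuples_def ideal_zero[OF assms(2)])
  with module_hom.zero[OF aug_hom] show ?case by (rule bexI)
next
  case (step c x y)
  obtain a b where ab: "x = a * b" "a \<in> A" "b \<in> P" using step(1) by blast
  obtain v where v: "v \<in> tuples (J 0) UNIV" "aug v = b" using ab(3) aug_surj by blast
  obtain u where u: "u \<in> tuples (J 0) A" "aug u = y" using step(2) by blast
  have "smul (c * a) v + u \<in> tuples (J 0) A"
  proof (rule tuplesI)
    show "(smul (c * a) v + u) j \<in> A" for j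
      unfolding plus_fun_apply smul_def
      by (intro ideal_add[OF assms(2)] ideal_mult_right[OF assms(2)] ideal_mult[OF assms(2) ab(2)]
          tuples_in[OF u(1) assms(2)])
    show "(smul (c * a) v + u) j = 0" if "j \<notin> J 0" for j
      using v(1) u(1) that by (simp add: tuples_def smul_def)
  qed
  moreover have "aug (smul (c * a) v + u) = c * x + y"
    by (simp add: module_hom.add[OF aug_hom] module_hom.scale[OF aug_hom] v(2) u(2) ab(1) mult.assoc)
  ultimately show ?case by blast
qed

lemma aug_ideal_prod:
  assumes "v \<in> tuples (J 0) A" shows "aug v \<in> ideal_prod A P"
  unfolding hom_tuples_expand[OF aug_hom fin assms]
proof (intro ideal_sum[OF is_ideal_ideal_prod] ideal_prodI)
  fix j assume j: "j \<in> J 0"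
  show "v j \<in> A" using assms j by (simp add: tuples_def)
  show "aug (basis j) \<in> P" using basis_tuples[OF j] aug_surj by blast
qed

text \<open>
  A cycle over \<open>\<mm>\<^sup>q\<^sup>+\<^sup>1 P\<close> is lifted along the augmentation to a family with entries in \<open>\<mm>\<^sup>q\<^sup>+\<^sup>1 Y\<^sub>0\<close>,
  which is a Koszul cycle modulo the kernel \<open>B\<^sub>0\<close> of the augmentation.
\<close>
lemma koszul_vanishing_pow_prod:
  "koszul_vanishing (ideal_prod (ideal_pow max_ideal (Suc q)) P) (ideal_prod (ideal_pow max_ideal q) P)"
  unfolding koszul_vanishing_def
proof (intro allI ballI impI)
  fix i and z :: "'x set \<Rightarrow> ('x, 'k) mpoly"
  assume z: "z \<in> tuples (faces i) (ideal_prod (ideal_pow max_ideal (Suc q)) P)" "kdiff z = 0"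
  have "\<exists>v. v \<in> tuples (J 0) (ideal_pow max_ideal (Suc q)) \<and> aug v = z S" for S
    using ideal_prod_lift[OF tuples_in[OF z(1) is_ideal_ideal_prod] is_ideal_ideal_pow] by blast
  then obtain v where v: "\<And>S. v S \<in> tuples (J 0) (ideal_pow max_ideal (Suc q))"
      "\<And>S. aug (v S) = z S" by metis
  define Z where "Z c S = (if S \<in> faces i then v S c else 0)" for c S
  have Z_col: "(\<lambda>c. Z c S) = (if S \<in> faces i then v S else 0)" for S by (auto simp: Z_def)
  have Z: "Z \<in> bituples (faces i) (J 0) (ideal_pow max_ideal (Suc q))"
  proof (rule bituples_from_columns[OF _ _ is_ideal_ideal_pow])
    show "(\<lambda>c. Z c S) \<in> tuples (J 0) (ideal_pow max_ideal (Suc q))" for S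
      unfolding Z_col using v(1)
      by (auto simp: tuples_def ideal_zero[OF is_ideal_ideal_pow] simp del: ideal_pow.simps)
  qed (simp add: Z_def)
  have aug_Z: "aug (\<lambda>c. Z c S) = z S" for S
    using tuples_outside[OF z(1), of S] by (simp add: Z_col v(2) module_hom.zero[OF aug_hom])
  have "(\<lambda>c. kdiff (Z c) S) \<in> cyc 0" for S
    unfolding cyc_0
  proof (intro CollectI conjI)
    show "(\<lambda>c. kdiff (Z c) S) \<in> tuples (J 0) UNIV"
    proof (rule tuplesI)
      show "kdiff (Z c) S = 0" if "c \<notin> J 0" for c
      proof -
        have "Z c = 0" using Z that by (auto simp: bituples_def)
        thus ?thesis by (simp add: module_hom.zero[OF rhom_kdiff])
      qed
    qed simp
    show "aug (\<lambda>c. kdiff (Z c) S) = 0"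
      by (simp add: functional_kdiff_commute[OF aug_hom] aug_Z z(2))
  qed
  then obtain W where W: "W \<in> bituples (faces (Suc i)) (J 0) (ideal_pow max_ideal q)"
      "\<And>S. (\<lambda>c. Z c S - kdiff (W c) S) \<in> cyc 0"
    using koszul_cycles_bound[OF Z] by blast
  show "\<exists>y\<in>tuples (faces (Suc i)) (ideal_prod (ideal_pow max_ideal q) P). kdiff y = z"
  proof
    show "(\<lambda>S. aug (\<lambda>c. W c S)) \<in> tuples (faces (Suc i)) (ideal_prod (ideal_pow max_ideal q) P)"
    proof (rule tuplesI)
      show "aug (\<lambda>c. W c S) \<in> ideal_prod (ideal_pow max_ideal q) P" for S
        by (rule aug_ideal_prod[OF bituples_column[OF W(1)]])
      show "aug (\<lambda>c. W c S) = 0" if "S \<notin> faces (Suc i)" for S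
      proof -
        have "(\<lambda>c. W c S) = 0" using W(1) that by (auto simp: bituples_def)
        thus ?thesis by (simp add: module_hom.zero[OF aug_hom])
      qed
    qed
    show "kdiff (\<lambda>S. aug (\<lambda>c. W c S)) = z"
    proof
      fix S
      have "aug ((\<lambda>c. Z c S) - (\<lambda>c. kdiff (W c) S)) = 0"
        using W(2)[of S] by (simp add: cyc_0 fun_diff_def)
      thus "kdiff (\<lambda>S. aug (\<lambda>c. W c S)) S = z S"
        by (simp add: module_hom.diff[OF aug_hom] functional_kdiff_commute[OF aug_hom] aug_Z)
    qed
  qed
qed

end

text \<open>
  The inclusion factors through \<open>\<mm>\<^sup>p\<^sup>+\<^sup>2 I\<^sup>n \<subseteq> \<mm>\<^sup>p\<^sup>+\<^sup>1 I\<^sup>n\<close>, so only the Koszul property of the target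
  power \<open>I\<^sup>n\<close> enters. For \<open>n = 0\<close> that power is the ring itself.
\<close>
lemma koszul_vanishing_koszul_powers:
  fixes I :: "('x::finite, 'k::field) mpoly set"
  assumes "I \<subseteq> ideal_pow max_ideal 2" and "n = 0 \<or> koszul_module (*) (ideal_pow I n) gr"
  shows "koszul_vanishing (ideal_prod (ideal_pow max_ideal p) (ideal_pow I (Suc n)))
    (ideal_prod (ideal_pow max_ideal (Suc p)) (ideal_pow I n))"
proof -
  have "koszul_vanishing (ideal_prod (ideal_pow max_ideal (Suc (Suc p))) (ideal_pow I n))
    (ideal_prod (ideal_pow max_ideal (Suc p)) (ideal_pow I n))"
  proof (cases "n = 0")
    case True
    have "ideal_prod (ideal_pow max_ideal k) (ideal_pow I n) = ideal_pow max_ideal k" for k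
      by (simp add: True ideal_prod_commute[of _ UNIV] ideal_prod_UNIV is_ideal_ideal_pow)
    thus ?thesis by (simp add: koszul_vanishing_max_ideal_pow del: ideal_pow.simps)
  next
    case False
    thus ?thesis
      using assms(2) koszul_module_linear_resolution linear_resolution.koszul_vanishing_pow_prod by blast
  qed
  thus ?thesis
    using ideal_prod_pow_Suc_subset[OF assms(1), of p n]
    by (elim koszul_vanishing_mono) simp_all
qed

theorem lemma4p1:
  fixes I :: "('x::finite, 'k::field) mpoly set" and s :: nat
  assumes "homogeneous_ideal I"
    and "I \<subseteq> ideal_pow max_ideal 2"
    and "s \<ge> 1"
    and "CHAR('k) = 0 \<or> monomial_ideal I \<or>
         (\<forall>t. 1 \<le> t \<and> t \<le> s \<longrightarrow> koszul_module (*) (ideal_pow I t) hom_part)"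
  shows "\<forall>t. 1 \<le> t \<and> t \<le> s \<longrightarrow>
           tor_vanishing
             (*) (ideal_prod (ideal_pow max_ideal (s - t)) (ideal_pow I t))
             (*) (ideal_prod (ideal_pow max_ideal (s - t + 1)) (ideal_pow I (t - 1)))
             (\<lambda>x. x)"
proof (intro allI impI)
  fix t assume t: "1 \<le> t \<and> t \<le> s"
  define n where "n = t - 1"
  have tn: "t = Suc n" "t - 1 = n" using t by (simp_all add: n_def)
  let ?M = "ideal_prod (ideal_pow max_ideal (s - t)) (ideal_pow I (Suc n))"
  let ?N = "ideal_prod (ideal_pow max_ideal (Suc (s - t))) (ideal_pow I n)"
  have "?M \<subseteq> ideal_prod (ideal_pow max_ideal (s - t + 2)) (ideal_pow I n)"
    by (rule ideal_prod_pow_Suc_subset[OF assms(2)])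
  also have "\<dots> \<subseteq> ?N"
    by (rule ideal_prod_mono[OF ideal_pow_antimono order_refl]) simp
  finally have sub: "?M \<subseteq> ?N" .
  consider "CHAR('k) = 0" | "monomial_ideal I" | "n = 0 \<or> koszul_module (*) (ideal_pow I n) hom_part"
  proof -
    have "n = 0 \<or> 1 \<le> n \<and> n \<le> s" using t by (auto simp: n_def)
    thus thesis using assms(4) that by blast
  qed
  hence "koszul_vanishing ?M ?N"
  proof cases
    case 1 thus ?thesis by (rule koszul_vanishing_char_0[OF _ assms(1,2)])
  next
    case 2 thus ?thesis by (rule koszul_vanishing_monomial[OF _ assms(2)])
  next
    case 3 thus ?thesis by (rule koszul_vanishing_koszul_powers[OF assms(2)])
  qed
  hence "tor_vanishing (*) ?M (*) ?N (\<lambda>x. x)"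
    by (rule tor_vanishing_of_koszul_vanishing[OF is_ideal_ideal_prod is_ideal_ideal_prod sub])
  thus "tor_vanishing (*) (ideal_prod (ideal_pow max_ideal (s - t)) (ideal_pow I t))
      (*) (ideal_prod (ideal_pow max_ideal (s - t + 1)) (ideal_pow I (t - 1))) (\<lambda>x. x)"
    unfolding tn(2) by (simp add: tn(1) del: ideal_pow.simps)
qed

end
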